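(* There exists a nondegenerate Orlicz function $M$ such that $\alpha_M=\beta_M=2$ and such that, for every $1\leq p\leq2$, the Orlicz sequence space $h_M$ does not coarsely embed into $\ell_p$ and does not uniformly embed into $\ell_p$.
   Context: All Banach spaces are real; $\ell_p$ is the usual space of real $p$-summable sequences. Orlicz functions and spaces. A function $M:[0,\infty)\to[0,\infty)$ is an Orlicz function if it is continuous, nondecreasing and convex, $M(0)=0$ and $\lim_{t\to\infty}M(t)=\infty$. It is nondegenerate if $M(t)>0$ for all $t>0$. $\ell_M$ is the Banach space of real sequences $x=(x_n)_{n=1}^\infty$ with $\sum_n M(|x_n|/\rho)<\infty$ for some $\rho>0$, with norm $\|x\|=\inf\{\rho>0:\sum_{n=1}^\infty M(|x_n|/\rho)\leq1\}$. $h_M$ is the closed subspace of $\ell_M$ of those $x$ with $\sum_n M(|x_n|/\rho)<\infty$ for every $\rho>0$, with the inherited norm. Lower and upper Matuszewska-Orlicz indices: $\alpha_M=\sup\left\{q\in\mathbb{R}:\sup_{\lambda,t\in(0,1]}\frac{M(\lambda t)}{M(\lambda)t^q}<\infty\right\}$ and $\beta_M=\inf\left\{q\in\mathbb{R}:\inf_{\lambda,t\in(0,1]}\frac{M(\lambda t)}{M(\lambda)t^q}>0\right\}$, with $\inf\emptyset=\infty$. Embeddings. Let $f:X\to Y$ be a map between metric spaces $(X,d_X),(Y,d_Y)$. $f$ is a coarse embedding if there are nondecreasing $\rho_1,\rho_2:[0,\infty)\to[0,\infty)$ with $\lim_{t\to\infty}\rho_1(t)=\infty$ and $\rho_1(d_X(x,y))\leq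 d_Y(f(x),f(y))\leq\rho_2(d_X(x,y))$ for all $x,y\in X$. $f$ is a uniform embedding if it is injective and both $f$ and $f^{-1}:f(X)\to X$ are uniformly continuous. $X$ coarsely (respectively uniformly) embeds into $Y$ if there exists a coarse (respectively uniform) embedding $X\to Y$. *)

theory Defs
  imports "HOL-Analysis.Analysis" "HOL-Real_Asymp.Real_Asymp"
begin

section \<open>Orlicz functions and Matuszewska--Orlicz indices\<close>

text \<open>Functions on \<open>[0,\<infinity>)\<close> are total functions on the reals whose values at negative
  arguments are never used.\<close>

definition orlicz_function :: "(real \<Rightarrow> real) \<Rightarrow> bool" where
  "orlicz_function M \<longleftrightarrow>
     M \<in> {0..} \<rightarrow> {0..} \<and> continuous_on {0..} M \<and> mono_on {0..} M \<and> convex_on {0..} M \<and>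
     M 0 = 0 \<and> filterlim M at_top at_top"

definition nondegenerate :: "(real \<Rightarrow> real) \<Rightarrow> bool" where
  "nondegenerate M \<longleftrightarrow> (\<forall>t>0. M t > 0)"

text \<open>The quotients in the indices are meaningful for nondegenerate \<open>M\<close>.\<close>

definition lower_index :: "(real \<Rightarrow> real) \<Rightarrow> ereal" where
  "lower_index M =
     Sup (ereal ` {q. (SUP (l, t) \<in> {0<..1} \<times> {0<..1}. ereal (M (l * t) / (M l * t powr q))) < \<infinity>})"

definition upper_index :: "(real \<Rightarrow> real) \<Rightarrow> ereal" where
  "upper_index M =
     Inf (ereal ` {q. (INF (l, t) \<in> {0<..1} \<times> {0<..1}. ereal (M (l * t) / (M l * t powr q))) > 0})"

section \<open>Orlicz sequence spaces\<close>

definition orlicz_space :: "(real \<Rightarrow> real) \<Rightarrow> (nat \<Rightarrow> real) set" where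
  "orlicz_space M = {x. \<exists>\<rho>>0. summable (\<lambda>n. M (\<bar>x n\<bar> / \<rho>))}"

definition orlicz_heart :: "(real \<Rightarrow> real) \<Rightarrow> (nat \<Rightarrow> real) set" where
  "orlicz_heart M = {x \<in> orlicz_space M. \<forall>\<rho>>0. summable (\<lambda>n. M (\<bar>x n\<bar> / \<rho>))}"

text \<open>The value 0 outside the space only serves to make the norm a total nonnegative function, as
  \<^locale>\<open>Metric_space\<close> requires of distances.\<close>

definition orlicz_norm :: "(real \<Rightarrow> real) \<Rightarrow> (nat \<Rightarrow> real) \<Rightarrow> real" where
  "orlicz_norm M x =
     (if x \<in> orlicz_space M
      then Inf {\<rho>. \<rho> > 0 \<and> summable (\<lambda>n. M (\<bar>x n\<bar> / \<rho>)) \<and> (\<Sum>n. M (\<bar>x n\<bar> / \<rho>)) \<le> 1}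
      else 0)"

definition orlicz_metric :: "(real \<Rightarrow> real) \<Rightarrow> (nat \<Rightarrow> real) metric" where
  "orlicz_metric M = metric (orlicz_space M, \<lambda>x y. orlicz_norm M (\<lambda>n. x n - y n))"

definition orlicz_heart_metric :: "(real \<Rightarrow> real) \<Rightarrow> (nat \<Rightarrow> real) metric" where
  "orlicz_heart_metric M = submetric (orlicz_metric M) (orlicz_heart M)"

section \<open>The spaces of \<open>p\<close>-summable sequences\<close>

definition lp_space :: "real \<Rightarrow> (nat \<Rightarrow> real) set" where
  "lp_space p = {x. summable (\<lambda>n. \<bar>x n\<bar> powr p)}"

definition lp_norm :: "real \<Rightarrow> (nat \<Rightarrow> real) \<Rightarrow> real" where
  "lp_norm p x = (\<Sum>n. \<bar>x n\<bar> powr p) powr (1 / p)"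

definition lp_metric :: "real \<Rightarrow> (nat \<Rightarrow> real) metric" where
  "lp_metric p = metric (lp_space p, \<lambda>x y. lp_norm p (\<lambda>n. x n - y n))"

section \<open>Coarse and uniform embeddings\<close>

definition coarse_embedding :: "'a metric \<Rightarrow> 'b metric \<Rightarrow> ('a \<Rightarrow> 'b) \<Rightarrow> bool" where
  "coarse_embedding X Y f \<longleftrightarrow>
     f \<in> mspace X \<rightarrow> mspace Y \<and>
     (\<exists>\<rho>1 \<rho>2 :: real \<Rightarrow> real.
        \<rho>1 \<in> {0..} \<rightarrow> {0..} \<and> \<rho>2 \<in> {0..} \<rightarrow> {0..} \<and> mono_on {0..} \<rho>1 \<and> mono_on {0..} \<rho>2 \<and>
        filterlim \<rho>1 at_top at_top \<and>
        (\<forall>x\<in>mspace X. \<forall>y\<in>mspace X.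
           \<rho>1 (mdist X x y) \<le> mdist Y (f x) (f y) \<and> mdist Y (f x) (f y) \<le> \<rho>2 (mdist X x y)))"

definition uniform_embedding :: "'a metric \<Rightarrow> 'b metric \<Rightarrow> ('a \<Rightarrow> 'b) \<Rightarrow> bool" where
  "uniform_embedding X Y f \<longleftrightarrow>
     inj_on f (mspace X) \<and> uniformly_continuous_map X Y f \<and>
     uniformly_continuous_map (submetric Y (f ` mspace X)) X (inv_into (mspace X) f)"

definition coarsely_embeds :: "'a metric \<Rightarrow> 'b metric \<Rightarrow> bool" where
  "coarsely_embeds X Y \<longleftrightarrow> (\<exists>f. coarse_embedding X Y f)"

definition uniformly_embeds :: "'a metric \<Rightarrow> 'b metric \<Rightarrow> bool" where
  "uniformly_embeds X Y \<longleftrightarrow> (\<exists>f. uniform_embedding X Y f)"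

section \<open>The sequence spaces are metric spaces\<close>

text \<open>The type constructor \<^typ>\<open>'a metric\<close> is only meaningful on actual metric spaces, so the
  metric axioms are verified here.\<close>

lemma orlicz_pos: "M t \<ge> 0" if "orlicz_function M" "t \<ge> 0"
  using that by (auto simp: orlicz_function_def)

lemma orlicz_mono: "M s \<le> M t" if "orlicz_function M" "0 \<le> s" "s \<le> t"
  using that by (auto simp: orlicz_function_def mono_on_def)

lemma orlicz_convex:
  "M (u * s + v * t) \<le> u * M s + v * M t"
  if "orlicz_function M" "0 \<le> s" "0 \<le> t" "0 \<le> u" "0 \<le> v" "u + v = 1"
  using that by (auto simp: orlicz_function_def convex_on_def)

lemma orlicz_scale:
  "M (u * t) \<le> u * M t" if "orlicz_function M" "0 \<le> t" "0 \<le> u" "u \<le> 1"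
  using orlicz_convex[of M t 0 u "1 - u"] that by (simp add: orlicz_function_def)

definition orlicz_radii :: "(real \<Rightarrow> real) \<Rightarrow> (nat \<Rightarrow> real) \<Rightarrow> real set" where
  "orlicz_radii M x = {\<rho>. \<rho> > 0 \<and> summable (\<lambda>n. M (\<bar>x n\<bar> / \<rho>)) \<and> (\<Sum>n. M (\<bar>x n\<bar> / \<rho>)) \<le> 1}"

lemma orlicz_radii_bdd [simp]: "bdd_below (orlicz_radii M x)"
  unfolding orlicz_radii_def by (rule bdd_belowI[of _ 0]) auto

lemma orlicz_radii_nonempty:
  assumes M: "orlicz_function M" and x: "x \<in> orlicz_space M"
  shows "orlicz_radii M x \<noteq> {}"
proof -
  obtain r where r: "r > 0" and s: "summable (\<lambda>n. M (\<bar>x n\<bar> / r))"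
    using x by (auto simp: orlicz_space_def)
  define S where "S = (\<Sum>n. M (\<bar>x n\<bar> / r))"
  have S: "S \<ge> 0"
    unfolding S_def using s r by (intro suminf_nonneg) (auto intro!: orlicz_pos[OF M])
  define u where "u = 1 / (1 + S)"
  have u: "u > 0" "u \<le> 1" using S by (auto simp: u_def)
  have le: "M (\<bar>x n\<bar> / (r / u)) \<le> u * M (\<bar>x n\<bar> / r)" for n
    using orlicz_scale[OF M, of "\<bar>x n\<bar> / r" u] r u by (simp add: mult.commute)
  have su: "summable (\<lambda>n. u * M (\<bar>x n\<bar> / r))" using s by (rule summable_mult)
  have 1: "summable (\<lambda>n. M (\<bar>x n\<bar> / (r / u)))"
    using r u by (intro summable_comparison_test'[OF su, of 0])
      (use le in \<open>auto simp: orlicz_pos[OF M]\<close>)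
  have "(\<Sum>n. M (\<bar>x n\<bar> / (r / u))) \<le> (\<Sum>n. u * M (\<bar>x n\<bar> / r))"
    by (intro suminf_le le 1 su)
  also have "\<dots> = u * S" unfolding S_def using s by (rule suminf_mult)
  also have "\<dots> \<le> 1" using S by (simp add: u_def)
  finally have "r / u \<in> orlicz_radii M x" using 1 r u by (auto simp: orlicz_radii_def)
  then show ?thesis by blast
qed

lemma orlicz_norm_eq: "orlicz_norm M x = Inf (orlicz_radii M x)" if "x \<in> orlicz_space M"
  using that by (simp add: orlicz_norm_def orlicz_radii_def)

lemma orlicz_norm_nonneg: "0 \<le> orlicz_norm M x" if "orlicz_function M"
proof (cases "x \<in> orlicz_space M")
  case True
  show ?thesis unfolding orlicz_norm_eq[OF True]
    by (rule cInf_greatest[OF orlicz_radii_nonempty[OF that True]]) (auto simp: orlicz_radii_def)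
qed (simp add: orlicz_norm_def)

lemma orlicz_norm_commute:
  "orlicz_norm M (\<lambda>n. x n - y n) = orlicz_norm M (\<lambda>n. y n - x n)"
  unfolding orlicz_norm_def orlicz_space_def mem_Collect_eq abs_minus_commute[of "x _" "y _"]
  by (rule refl)

lemma orlicz_convex_sum:
  assumes M: "orlicz_function M" and r: "r > 0" and s: "s > 0"
  shows "M (\<bar>a + b\<bar> / (r + s)) \<le> r / (r + s) * M (\<bar>a\<bar> / r) + s / (r + s) * M (\<bar>b\<bar> / s)"
proof -
  have "r / (r + s) * (\<bar>a\<bar> / r) + s / (r + s) * (\<bar>b\<bar> / s) = (\<bar>a\<bar> + \<bar>b\<bar>) / (r + s)"
    using r s by (simp add: add_divide_distrib)
  then have "M (\<bar>a + b\<bar> / (r + s)) \<le> M (r / (r + s) * (\<bar>a\<bar> / r) + s / (r + s) * (\<bar>b\<bar> / s))"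
    using r s by (intro orlicz_mono[OF M]) (auto intro!: divide_right_mono)
  also have "\<dots> \<le> r / (r + s) * M (\<bar>a\<bar> / r) + s / (r + s) * M (\<bar>b\<bar> / s)"
    using r s by (intro orlicz_convex[OF M]) (auto simp: add_divide_distrib[symmetric])
  finally show ?thesis .
qed

lemma orlicz_radii_add:
  assumes M: "orlicz_function M" and r: "r \<in> orlicz_radii M x" and s: "s \<in> orlicz_radii M y"
  shows "r + s \<in> orlicz_radii M (\<lambda>n. x n + y n)"
proof -
  have rs: "r > 0" "s > 0" "summable (\<lambda>n. M (\<bar>x n\<bar> / r))" "summable (\<lambda>n. M (\<bar>y n\<bar> / s))"
    "(\<Sum>n. M (\<bar>x n\<bar> / r)) \<le> 1" "(\<Sum>n. M (\<bar>y n\<bar> / s)) \<le> 1"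
    using r s by (auto simp: orlicz_radii_def)
  let ?h = "\<lambda>n. r / (r + s) * M (\<bar>x n\<bar> / r) + s / (r + s) * M (\<bar>y n\<bar> / s)"
  have le: "M (\<bar>x n + y n\<bar> / (r + s)) \<le> ?h n" for n
    using orlicz_convex_sum[OF M] rs by blast
  have sh: "summable ?h" by (intro summable_add summable_mult rs)
  have 1: "summable (\<lambda>n. M (\<bar>x n + y n\<bar> / (r + s)))"
    using rs by (intro summable_comparison_test'[OF sh, of 0])
      (use le in \<open>auto simp: orlicz_pos[OF M]\<close>)
  have "(\<Sum>n. M (\<bar>x n + y n\<bar> / (r + s))) \<le> suminf ?h"
    by (intro suminf_le le 1 sh)
  also have "\<dots> = r / (r + s) * (\<Sum>n. M (\<bar>x n\<bar> / r)) + s / (r + s) * (\<Sum>n. M (\<bar>y n\<bar> / s))"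
    using rs by (simp add: suminf_add[symmetric] suminf_mult summable_mult del: times_divide_eq_left)
  also have "\<dots> \<le> r / (r + s) * 1 + s / (r + s) * 1"
    using rs by (intro add_mono mult_left_mono) auto
  also have "\<dots> = 1" using rs by (simp add: add_divide_distrib[symmetric])
  finally show ?thesis using 1 rs by (auto simp: orlicz_radii_def)
qed

lemma orlicz_space_add:
  assumes M: "orlicz_function M" and x: "x \<in> orlicz_space M" and y: "y \<in> orlicz_space M"
  shows "(\<lambda>n. x n + y n) \<in> orlicz_space M"
proof -
  obtain r s where "r \<in> orlicz_radii M x" "s \<in> orlicz_radii M y"
    using orlicz_radii_nonempty[OF M x] orlicz_radii_nonempty[OF M y] by blast
  from orlicz_radii_add[OF M this] show ?thesis
    by (auto simp: orlicz_radii_def orlicz_space_def)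
qed

lemma orlicz_space_diff:
  assumes M: "orlicz_function M" and x: "x \<in> orlicz_space M" and y: "y \<in> orlicz_space M"
  shows "(\<lambda>n. x n - y n) \<in> orlicz_space M"
  using orlicz_space_add[OF M x, of "\<lambda>n. - y n"] y by (simp add: orlicz_space_def)

lemma orlicz_norm_triangle:
  assumes M: "orlicz_function M" and x: "x \<in> orlicz_space M" and y: "y \<in> orlicz_space M"
  shows "orlicz_norm M (\<lambda>n. x n + y n) \<le> orlicz_norm M x + orlicz_norm M y"
proof -
  have *: "orlicz_norm M (\<lambda>n. x n + y n) \<le> r + s"
    if "r \<in> orlicz_radii M x" "s \<in> orlicz_radii M y" for r s
    unfolding orlicz_norm_eq[OF orlicz_space_add[OF assms]]
    by (intro cInf_lower orlicz_radii_add[OF M] that) simp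
  have "orlicz_norm M (\<lambda>n. x n + y n) - s \<le> orlicz_norm M x" if "s \<in> orlicz_radii M y" for s
    unfolding orlicz_norm_eq[OF x]
    by (rule cInf_greatest[OF orlicz_radii_nonempty[OF M x]]) (use *[OF _ that] in fastforce)
  then have "orlicz_norm M (\<lambda>n. x n + y n) - orlicz_norm M x \<le> orlicz_norm M y"
    unfolding orlicz_norm_eq[OF y]
    by (intro cInf_greatest[OF orlicz_radii_nonempty[OF M y]]) fastforce
  then show ?thesis by simp
qed

lemma orlicz_norm_zero: "orlicz_norm M (\<lambda>n. 0) = 0" if M: "orlicz_function M"
proof -
  have M0: "M 0 = 0" using M by (simp add: orlicz_function_def)
  then have x: "(\<lambda>n. 0) \<in> orlicz_space M" by (auto simp: orlicz_space_def intro: exI[of _ 1])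
  have "orlicz_radii M (\<lambda>n. 0) = {0<..}" using M0 by (auto simp: orlicz_radii_def)
  then show ?thesis by (simp add: orlicz_norm_eq[OF x])
qed

lemma orlicz_norm_eq_zeroD:
  assumes M: "orlicz_function M" and x: "x \<in> orlicz_space M" and 0: "orlicz_norm M x = 0"
  shows "x n = 0"
proof (rule ccontr)
  assume n: "x n \<noteq> 0"
  have "eventually (\<lambda>t. M t > 1) at_top"
    using M by (auto simp: orlicz_function_def filterlim_at_top_dense)
  then obtain T where T: "\<And>t. t \<ge> T \<Longrightarrow> M t > 1" by (auto simp: eventually_at_top_linorder)
  define T' where "T' = max T 1"
  have T': "T' > 0" "T' \<ge> T" by (auto simp: T'_def)
  have "Inf (orlicz_radii M x) < \<bar>x n\<bar> / T'" using 0 n T' by (simp add: orlicz_norm_eq[OF x])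
  then obtain r where r: "r \<in> orlicz_radii M x" "r < \<bar>x n\<bar> / T'"
    using orlicz_radii_nonempty[OF M x] by (auto simp: cInf_less_iff)
  then have rp: "r > 0" and s: "summable (\<lambda>n. M (\<bar>x n\<bar> / r))" "(\<Sum>n. M (\<bar>x n\<bar> / r)) \<le> 1"
    by (auto simp: orlicz_radii_def)
  have "T \<le> \<bar>x n\<bar> / r" using r(2) rp T' by (simp add: field_simps) (smt (verit) mult_right_mono)
  then have "1 < M (\<bar>x n\<bar> / r)" by (rule T)
  also have "\<dots> = sum (\<lambda>n. M (\<bar>x n\<bar> / r)) {n}" by simp
  also have "\<dots> \<le> (\<Sum>n. M (\<bar>x n\<bar> / r))"
    using rp by (intro sum_le_suminf s) (auto simp: orlicz_pos[OF M])
  finally show False using s by simp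
qed

lemma Metric_space_orlicz:
  assumes M: "orlicz_function M"
  shows "Metric_space (orlicz_space M) (\<lambda>x y. orlicz_norm M (\<lambda>n. x n - y n))"
proof
  show "0 \<le> orlicz_norm M (\<lambda>n. x n - y n)" for x y by (rule orlicz_norm_nonneg[OF M])
  show "orlicz_norm M (\<lambda>n. x n - y n) = orlicz_norm M (\<lambda>n. y n - x n)" for x y
    by (rule orlicz_norm_commute)
next
  fix x y assume "x \<in> orlicz_space M" "y \<in> orlicz_space M"
  from orlicz_norm_eq_zeroD[OF M orlicz_space_diff[OF M this]] orlicz_norm_zero[OF M]
  show "(orlicz_norm M (\<lambda>n. x n - y n) = 0) = (x = y)" by force
next
  fix x y z assume *: "x \<in> orlicz_space M" "y \<in> orlicz_space M" "z \<in> orlicz_space M"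
  show "orlicz_norm M (\<lambda>n. x n - z n) \<le>
      orlicz_norm M (\<lambda>n. x n - y n) + orlicz_norm M (\<lambda>n. y n - z n)"
    using orlicz_norm_triangle[OF M orlicz_space_diff[OF M *(1,2)] orlicz_space_diff[OF M *(2,3)]]
    by simp
qed

lemma mspace_orlicz_metric: "orlicz_function M \<Longrightarrow> mspace (orlicz_metric M) = orlicz_space M"
  by (simp add: orlicz_metric_def Metric_space.mspace_metric[OF Metric_space_orlicz])

lemma mdist_orlicz_metric:
  "orlicz_function M \<Longrightarrow> mdist (orlicz_metric M) x y = orlicz_norm M (\<lambda>n. x n - y n)"
  by (simp add: orlicz_metric_def Metric_space.mdist_metric[OF Metric_space_orlicz])

lemma mspace_orlicz_heart_metric:
  "orlicz_function M \<Longrightarrow> mspace (orlicz_heart_metric M) = orlicz_heart M"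
  by (auto simp: orlicz_heart_metric_def mspace_orlicz_metric orlicz_heart_def)

lemma mdist_orlicz_heart_metric:
  "orlicz_function M \<Longrightarrow> mdist (orlicz_heart_metric M) x y = orlicz_norm M (\<lambda>n. x n - y n)"
  by (simp add: orlicz_heart_metric_def mdist_orlicz_metric)

text \<open>The metric axioms for \<open>\<ell>\<^sub>p\<close> follow from those for the Orlicz function \<open>t\<^sup>p\<close>.\<close>

lemma orlicz_function_powr:
  assumes p: "p \<ge> 1"
  shows "orlicz_function (\<lambda>t. t powr p)"
proof -
  have "filterlim (\<lambda>t::real. t powr p) at_top at_top"
    using p by real_asymp
  moreover have "continuous_on {0..} (\<lambda>t::real. t powr p)"
    using p by (intro continuous_on_powr' continuous_intros) auto
  moreover have "mono_on {0..} (\<lambda>t::real. t powr p)"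
    using p by (auto simp: mono_on_def intro: powr_mono2)
  moreover have "convex_on {0..} (\<lambda>t::real. t powr p)"
  proof (intro convex_onI)
    fix u s t :: real assume *: "0 < u" "u < 1" "s \<in> {0..}" "t \<in> {0..}"
    have scale: "(v * w) powr p \<le> v * w powr p" if "0 < v" "v < 1" "0 \<le> w" for v w :: real
    proof -
      have "v powr p \<le> v powr 1" using that p by (intro powr_mono') auto
      then show ?thesis using that by (auto simp: powr_mult intro!: mult_right_mono)
    qed
    consider "s = 0" | "t = 0" | "s > 0" "t > 0" using * by fastforce
    then show "((1 - u) *\<^sub>R s + u *\<^sub>R t) powr p \<le> (1 - u) * s powr p + u * t powr p"
    proof cases
      case 1 then show ?thesis using scale[of u t] * p by auto
    next
      case 2 then show ?thesis using scale[of "1 - u" s] * p by auto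
    next
      case 3 then show ?thesis using convex_onD[OF powr_convex[OF p], of u s t] * by auto
    qed
  qed auto
  ultimately show ?thesis by (auto simp: orlicz_function_def)
qed

lemma orlicz_space_powr:
  assumes p: "p \<ge> 1"
  shows "orlicz_space (\<lambda>t. t powr p) = lp_space p"
proof -
  have "summable (\<lambda>n. (\<bar>x n\<bar> / r) powr p) \<longleftrightarrow> summable (\<lambda>n. \<bar>x n\<bar> powr p)"
    if "r > 0" for r :: real and x :: "nat \<Rightarrow> real"
    using that by (simp add: powr_divide summable_divide_iff)
  then show ?thesis by (auto simp: orlicz_space_def lp_space_def intro: exI[of _ 1])
qed

lemma orlicz_norm_powr:
  assumes p: "p \<ge> 1" and x: "x \<in> lp_space p"
  shows "orlicz_norm (\<lambda>t. t powr p) x = lp_norm p x"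
proof -
  define S where "S = (\<Sum>n. \<bar>x n\<bar> powr p)"
  have s: "summable (\<lambda>n. \<bar>x n\<bar> powr p)" using x by (simp add: lp_space_def)
  have S: "S \<ge> 0" unfolding S_def using s by (intro suminf_nonneg) auto
  have "orlicz_radii (\<lambda>t. t powr p) x = {r. r > 0 \<and> S powr (1 / p) \<le> r}"
  proof -
    have "summable (\<lambda>n. (\<bar>x n\<bar> / r) powr p) \<and> (\<Sum>n. (\<bar>x n\<bar> / r) powr p) \<le> 1 \<longleftrightarrow> S powr (1 / p) \<le> r"
      if r: "r > 0" for r
    proof -
      have "summable (\<lambda>n. (\<bar>x n\<bar> / r) powr p)"
        using r s by (simp add: powr_divide summable_divide)
      moreover have "(\<Sum>n. (\<bar>x n\<bar> / r) powr p) = S / r powr p"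
        using r s by (simp add: powr_divide suminf_divide S_def)
      moreover have "S / r powr p \<le> 1 \<longleftrightarrow> S powr (1 / p) \<le> r"
      proof -
        have "S / r powr p \<le> 1 \<longleftrightarrow> S \<le> r powr p" using r by (simp add: field_simps)
        also have "\<dots> \<longleftrightarrow> S powr (1 / p) \<le> (r powr p) powr (1 / p)"
        proof
          assume "S \<le> r powr p"
          then show "S powr (1 / p) \<le> (r powr p) powr (1 / p)"
            using S p by (intro powr_mono2) auto
        next
          assume "S powr (1 / p) \<le> (r powr p) powr (1 / p)"
          then have "(S powr (1 / p)) powr p \<le> ((r powr p) powr (1 / p)) powr p"
            using p by (intro powr_mono2[of p "S powr (1 / p)"]) (simp_all del: powr_powr)
          then show "S \<le> r powr p" using S p r by (auto simp: powr_powr)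
        qed
        also have "(r powr p) powr (1 / p) = r" using p r by (simp add: powr_powr)
        finally show ?thesis .
      qed
      ultimately show ?thesis by simp
    qed
    then show ?thesis by (auto simp: orlicz_radii_def)
  qed
  also have "Inf \<dots> = S powr (1 / p)"
  proof (cases "S = 0")
    case True
    then have "{r. r > 0 \<and> S powr (1 / p) \<le> r} = {0<..}" by auto
    then show ?thesis using True by simp
  next
    case False
    then have "S powr (1 / p) > 0" by simp
    then have "{r. r > 0 \<and> S powr (1 / p) \<le> r} = {S powr (1 / p)..}"
      unfolding atLeast_def by (intro Collect_cong) linarith
    then show ?thesis by simp
  qed
  finally show ?thesis
    using x p by (simp add: orlicz_norm_eq orlicz_space_powr lp_norm_def S_def)
qed

lemma Metric_space_lp:
  assumes p: "p \<ge> 1"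
  shows "Metric_space (lp_space p) (\<lambda>x y. lp_norm p (\<lambda>n. x n - y n))"
proof -
  interpret O: Metric_space "lp_space p" "\<lambda>x y. orlicz_norm (\<lambda>t. t powr p) (\<lambda>n. x n - y n)"
    using Metric_space_orlicz[OF orlicz_function_powr[OF p]] by (simp add: orlicz_space_powr[OF p])
  have eq: "orlicz_norm (\<lambda>t. t powr p) (\<lambda>n. x n - y n) = lp_norm p (\<lambda>n. x n - y n)"
    if "x \<in> lp_space p" "y \<in> lp_space p" for x y
    using orlicz_space_diff[OF orlicz_function_powr[OF p], of x y] that
    by (simp add: orlicz_space_powr[OF p] orlicz_norm_powr[OF p])
  show ?thesis
  proof
    show "0 \<le> lp_norm p (\<lambda>n. x n - y n)" for x y by (simp add: lp_norm_def)
    show "lp_norm p (\<lambda>n. x n - y n) = lp_norm p (\<lambda>n. y n - x n)" for x y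
      by (simp add: lp_norm_def abs_minus_commute)
  qed (use O.zero O.triangle in \<open>simp_all add: eq\<close>)
qed

lemma mspace_lp_metric: "p \<ge> 1 \<Longrightarrow> mspace (lp_metric p) = lp_space p"
  by (simp add: lp_metric_def Metric_space.mspace_metric[OF Metric_space_lp])

lemma mdist_lp_metric: "p \<ge> 1 \<Longrightarrow> mdist (lp_metric p) x y = lp_norm p (\<lambda>n. x n - y n)"
  by (simp add: lp_metric_def Metric_space.mdist_metric[OF Metric_space_lp])

end

theory Submission
  imports Defs
begin

text \<open>Hilbert space has metric cotype 2 on the discrete torus (Mendel and Naor): for
  complex functions on \<open>(\<int>/2r)\<^sup>n\<close> with \<open>n \<le> 2r\<^sup>2\<close>, the displacements along half-turns of
  single coordinates are controlled, on average and in the mean square, by a multiple of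
  \<open>r\<^sup>2 / n\<close> times those along the vertices of the cube \<open>{0,1}\<^sup>n\<close>; this is a comparison of Fourier multipliers. Since \<open>|s|\<^sup>p\<close> is a
  positive mixture of the functions \<open>|exp (i t s) - 1|\<^sup>2\<close> for \<open>p < 2\<close>, the inequality passes to
  \<open>p\<close>-th powers of distances in \<open>\<ell>\<^sub>p\<close>, \<open>1 \<le> p \<le> 2\<close>.

  The Orlicz function is \<open>t\<^sup>2 / (1 - ln t)\<close> near \<open>0\<close>: the logarithm does not affect the
  indices, but makes \<open>M t = o(t\<^sup>2)\<close>. Hence the torus with \<open>n = 2r\<^sup>2\<close>, placed coordinatewise on circles of
  radius \<open>s\<close> in \<open>h\<^sub>M\<close>, has half-turn displacements at least \<open>s\<close> while its cube displacements tend
  to \<open>0\<close> as \<open>r\<close> grows, which neither a coarse nor a uniform embedding into \<open>\<ell>\<^sub>p\<close> can respect.\<close>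

section \<open>Fourier analysis on the discrete torus\<close>

text \<open>This set serves as the group of integer vectors modulo \<open>m\<close>, as its dual
  group of frequencies and, for \<open>m = 2\<close>, as the set of cube vertices by which one
  shifts.\<close>

definition discrete_torus :: "nat \<Rightarrow> nat \<Rightarrow> (nat \<Rightarrow> nat) set" where
  "discrete_torus n m = {..<n} \<rightarrow>\<^sub>E {..<m}"

text \<open>The shift \<open>v\<close> is any vector of naturals, so cube vertices and half-turns
  can be used without reducing them or restricting them to the torus.\<close>

definition torus_shift :: "nat \<Rightarrow> nat \<Rightarrow> (nat \<Rightarrow> nat) \<Rightarrow> (nat \<Rightarrow> nat) \<Rightarrow> nat \<Rightarrow> nat" where
  "torus_shift n m v x = (\<lambda>j\<in>{..<n}. (x j + v j) mod m)"

definition unity_root :: "nat \<Rightarrow> complex" where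
  "unity_root m = cis (2 * pi / m)"

definition torus_char :: "nat \<Rightarrow> nat \<Rightarrow> (nat \<Rightarrow> nat) \<Rightarrow> (nat \<Rightarrow> nat) \<Rightarrow> complex" where
  "torus_char n m k x = (\<Prod>j<n. unity_root m ^ (k j * x j))"

text \<open>Unnormalised, whence the factor \<open>m ^ n\<close> in Parseval's identity.\<close>

definition torus_fourier ::
    "nat \<Rightarrow> nat \<Rightarrow> ((nat \<Rightarrow> nat) \<Rightarrow> complex) \<Rightarrow> (nat \<Rightarrow> nat) \<Rightarrow> complex" where
  "torus_fourier n m f k = (\<Sum>x\<in>discrete_torus n m. f x * cnj (torus_char n m k x))"

lemma finite_discrete_torus [simp]: "finite (discrete_torus n m)"
  by (simp add: discrete_torus_def finite_PiE)

lemma card_discrete_torus: "card (discrete_torus n m) = m ^ n"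
  by (simp add: discrete_torus_def card_PiE)

lemma norm_unity_root [simp]: "norm (unity_root m) = 1"
  by (simp add: unity_root_def)

lemma unity_root_power_order: "m > 0 \<Longrightarrow> unity_root m ^ m = 1"
  by (simp add: unity_root_def Complex.DeMoivre)

lemma unity_root_power_mod: "m > 0 \<Longrightarrow> unity_root m ^ (a mod m) = unity_root m ^ a"
proof -
  assume "m > 0"
  then have "unity_root m ^ (m * (a div m) + a mod m) = unity_root m ^ (a mod m)"
    by (simp only: power_add power_mult unity_root_power_order power_one mult_1)
  then show ?thesis by simp
qed

lemma unity_root_half: "r > 0 \<Longrightarrow> unity_root (2 * r) ^ r = -1"
  by (simp add: unity_root_def Complex.DeMoivre)

lemma inj_on_unity_root_power: "m > 0 \<Longrightarrow> inj_on (\<lambda>a. unity_root m ^ a) {..<m}"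
  using Complex.bij_betw_roots_unity[of m]
  by (simp add: bij_betw_def unity_root_def Complex.DeMoivre inj_on_def mult_ac)

lemma norm_cis_minus_one_le: "norm (cis t - 1) \<le> \<bar>t\<bar>"
proof -
  have "norm (cis t - 1) = 2 * \<bar>sin (t / 2)\<bar>"
    unfolding cis_conv_exp by (rule dist_exp_i_1)
  also have "\<dots> \<le> 2 * \<bar>t / 2\<bar>" by (intro mult_left_mono abs_sin_x_le_abs_x) simp
  finally show ?thesis by simp
qed

lemma norm_unity_root_minus_one: "norm (unity_root m - 1) \<le> 2 * pi / m"
  using norm_cis_minus_one_le[of "2 * pi / m"] by (simp add: unity_root_def)

lemma cnj_mult_self_unit: "norm z = 1 \<Longrightarrow> cnj z * z = 1"
  by (metis complex_norm_square mult.commute of_real_1 one_power2)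

lemma norm_torus_char [simp]: "norm (torus_char n m k x) = 1"
  by (simp add: torus_char_def norm_power prod_norm[symmetric])

lemma torus_shift_in_torus [simp]: "m > 0 \<Longrightarrow> torus_shift n m v x \<in> discrete_torus n m"
  by (auto simp: torus_shift_def discrete_torus_def)

lemma torus_char_shift:
  "m > 0 \<Longrightarrow> torus_char n m k (torus_shift n m v x) = torus_char n m k x * torus_char n m k v"
  unfolding torus_char_def prod.distrib[symmetric]
proof (intro prod.cong refl)
  fix j assume "m > 0" "j \<in> {..<n}"
  then have "unity_root m ^ (torus_shift n m v x j * k j) =
      unity_root m ^ (x j * k j) * unity_root m ^ (v j * k j)"
    by (simp add: torus_shift_def power_mult unity_root_power_mod power_add power_mult_distrib)
  then show "unity_root m ^ (k j * torus_shift n m v x j) =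
      unity_root m ^ (k j * x j) * unity_root m ^ (k j * v j)"
    by (simp only: mult.commute)
qed

lemma add_mod_cancel_nat:
  fixes a b :: nat
  assumes "(a + c) mod m = (b + c) mod m" "a < m" "b < m"
  shows "a = b"
proof -
  have "(int a + int c) mod int m = (int b + int c) mod int m"
    using assms(1) by (simp flip: of_nat_add zmod_int)
  then have "int m dvd int a - int b" by (simp add: mod_eq_dvd_iff)
  then have "int m dvd \<bar>int a - int b\<bar>" by simp
  then show ?thesis using assms(2,3) zdvd_not_zless[of "\<bar>int a - int b\<bar>" "int m"] by linarith
qed

lemma bij_betw_torus_shift:
  assumes m: "m > 0"
  shows "bij_betw (torus_shift n m v) (discrete_torus n m) (discrete_torus n m)"
proof -
  have "inj_on (torus_shift n m v) (discrete_torus n m)"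
  proof (rule inj_onI)
    fix x y assume x: "x \<in> discrete_torus n m" and y: "y \<in> discrete_torus n m"
      and eq: "torus_shift n m v x = torus_shift n m v y"
    show "x = y"
    proof (rule PiE_ext[OF x[unfolded discrete_torus_def] y[unfolded discrete_torus_def]])
      fix j assume j: "j \<in> {..<n}"
      have eqj: "(x j + v j) mod m = (y j + v j) mod m"
        using fun_cong[OF eq, of j] j by (simp add: torus_shift_def)
      have "x j < m" "y j < m" using x y j by (auto simp: discrete_torus_def PiE_iff)
      then show "x j = y j" by (rule add_mod_cancel_nat[OF eqj])
    qed
  qed
  moreover have "torus_shift n m v ` discrete_torus n m \<subseteq> discrete_torus n m"
    using m by auto
  ultimately show ?thesis
    by (simp add: bij_betw_def endo_inj_surj)
qed

text \<open>The sum over frequencies factors into one geometric sum per coordinate. Where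
  \<open>x\<close> and \<open>y\<close> differ, the ratio is an \<open>m\<close>-th root of unity
  other than 1, and that sum vanishes.\<close>

lemma sum_torus_char_orthogonal:
  assumes m: "m > 0" and x: "x \<in> discrete_torus n m" and y: "y \<in> discrete_torus n m"
  shows "(\<Sum>k\<in>discrete_torus n m. cnj (torus_char n m k x) * torus_char n m k y) =
    (if x = y then of_nat (m ^ n) else 0)"
proof -
  let ?w = "unity_root m"
  define z where "z j = cnj (?w ^ x j) * ?w ^ y j" for j
  have "(\<Sum>k\<in>discrete_torus n m. cnj (torus_char n m k x) * torus_char n m k y) =
      (\<Sum>k\<in>{..<n} \<rightarrow>\<^sub>E {..<m}. \<Prod>j<n. z j ^ k j)"
    by (simp add: discrete_torus_def torus_char_def z_def prod.distrib[symmetric]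
        power_mult_distrib power_mult[symmetric] mult.commute)
  also have "\<dots> = (\<Prod>j<n. \<Sum>k<m. z j ^ k)"
    by (subst prod_sum_PiE) auto
  also have "\<dots> = (if x = y then of_nat (m ^ n) else 0)"
  proof (cases "x = y")
    case True
    then have "z j = 1" for j unfolding z_def using cnj_mult_self_unit[of "?w ^ y j"] by (simp add: norm_power)
    then show ?thesis using True by simp
  next
    case False
    then obtain j where j: "j < n" "x j \<noteq> y j"
      using x y PiE_ext unfolding discrete_torus_def by (metis lessThan_iff)
    have "x j < m" "y j < m" using x y j by (auto simp: discrete_torus_def PiE_iff)
    then have "?w ^ x j \<noteq> ?w ^ y j"
      using inj_on_unity_root_power[OF m] j by (auto simp: inj_on_def)
    moreover have "?w ^ x j * z j = ?w ^ y j"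
      unfolding z_def using cnj_mult_self_unit[of "?w ^ x j"] by (simp add: norm_power mult_ac)
    ultimately have z1: "z j \<noteq> 1" by auto
    have "(?w ^ a) ^ m = 1" for a
      using unity_root_power_order[OF m] by (metis mult.commute power_mult power_one)
    then have "z j ^ m = 1"
      unfolding z_def power_mult_distrib complex_cnj_power[symmetric] by simp
    then have "(\<Sum>k<m. z j ^ k) = 0" using z1 geometric_sum[of "z j" m] by simp
    then show ?thesis using False j by (auto intro!: prod_zero)
  qed
  finally show ?thesis .
qed

text \<open>Expand the square over pairs of points and sum over the frequencies first: orthogonality
  keeps only the diagonal.\<close>

lemma torus_parseval:
  assumes m: "m > 0"
  shows "(\<Sum>k\<in>discrete_torus n m. (norm (torus_fourier n m f k))\<^sup>2) =
    real (m ^ n) * (\<Sum>x\<in>discrete_torus n m. (norm (f x))\<^sup>2)"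
proof -
  let ?T = "discrete_torus n m"
  have "complex_of_real (\<Sum>k\<in>?T. (norm (torus_fourier n m f k))\<^sup>2) =
      (\<Sum>k\<in>?T. \<Sum>x\<in>?T. \<Sum>y\<in>?T.
        f x * cnj (f y) * (cnj (torus_char n m k x) * torus_char n m k y))"
    unfolding of_real_sum complex_norm_square torus_fourier_def
    by (simp add: sum_product mult_ac)
  also have "\<dots> = (\<Sum>x\<in>?T. \<Sum>y\<in>?T. \<Sum>k\<in>?T.
        f x * cnj (f y) * (cnj (torus_char n m k x) * torus_char n m k y))"
    by (subst sum.swap, rule sum.cong[OF refl], rule sum.swap)
  also have "\<dots> = (\<Sum>x\<in>?T. \<Sum>y\<in>?T. f x * cnj (f y) * (if x = y then of_nat (m ^ n) else 0))"
    by (simp add: sum_distrib_left[symmetric] sum_torus_char_orthogonal[OF m] cong: sum.cong)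
  also have "\<dots> = (\<Sum>x\<in>?T. of_nat (m ^ n) * (f x * cnj (f x)))"
    by (simp add: if_distrib mult.commute cong: if_cong)
  also have "\<dots> = complex_of_real (real (m ^ n) * (\<Sum>x\<in>?T. (norm (f x))\<^sup>2))"
    unfolding of_real_mult of_real_sum complex_norm_square by (simp add: sum_distrib_left)
  finally show ?thesis unfolding of_real_eq_iff .
qed

lemma torus_fourier_shift:
  assumes m: "m > 0"
  shows "torus_fourier n m (\<lambda>x. f (torus_shift n m v x)) k =
    torus_char n m k v * torus_fourier n m f k"
proof -
  let ?T = "discrete_torus n m"
  have "torus_fourier n m f k =
      (\<Sum>x\<in>?T. f (torus_shift n m v x) * cnj (torus_char n m k (torus_shift n m v x)))"
    unfolding torus_fourier_def
    by (rule sum.reindex_bij_betw[OF bij_betw_torus_shift[OF m], symmetric])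
  then have "torus_char n m k v * torus_fourier n m f k =
      (\<Sum>x\<in>?T. f (torus_shift n m v x) * cnj (torus_char n m k x) *
        (cnj (torus_char n m k v) * torus_char n m k v))"
    by (simp add: torus_char_shift[OF m] sum_distrib_left mult_ac)
  then show ?thesis by (simp add: cnj_mult_self_unit torus_fourier_def)
qed

text \<open>A shift multiplies each Fourier coefficient by a character value, so a displacement has
  multiplier \<open>torus_char n m k v - 1\<close>. Energy inequalities thereby reduce to
  inequalities between multipliers at each frequency.\<close>

lemma torus_shift_energy:
  assumes m: "m > 0"
  shows "real (m ^ n) * (\<Sum>x\<in>discrete_torus n m. (norm (f (torus_shift n m v x) - f x))\<^sup>2) =
    (\<Sum>k\<in>discrete_torus n m.
      (norm (torus_fourier n m f k))\<^sup>2 * (norm (torus_char n m k v - 1))\<^sup>2)"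
proof -
  have "torus_fourier n m (\<lambda>x. f (torus_shift n m v x) - f x) k =
      torus_fourier n m f k * (torus_char n m k v - 1)" for k
  proof -
    have "torus_fourier n m (\<lambda>x. f (torus_shift n m v x) - f x) k =
        torus_fourier n m (\<lambda>x. f (torus_shift n m v x)) k - torus_fourier n m f k"
      by (simp add: torus_fourier_def left_diff_distrib sum_subtractf)
    then show ?thesis by (simp add: torus_fourier_shift[OF m] algebra_simps)
  qed
  then show ?thesis
    using torus_parseval[OF m, of n "\<lambda>x. f (torus_shift n m v x) - f x"]
    by (simp add: norm_mult power_mult_distrib)
qed

section \<open>Multipliers of half-turns and of cube vertices\<close>

definition torus_axis :: "nat \<Rightarrow> nat \<Rightarrow> nat \<Rightarrow> nat" where
  "torus_axis j r i = (if i = j then r else 0)"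

lemma torus_char_axis: "j < n \<Longrightarrow> torus_char n m k (torus_axis j r) = unity_root m ^ (k j * r)"
proof -
  assume "j < n"
  then have "(\<Prod>i<n. unity_root m ^ (k i * torus_axis j r i)) =
      (\<Prod>i<n. if i = j then unity_root m ^ (k j * r) else 1)"
    by (intro prod.cong) (auto simp: torus_axis_def)
  with \<open>j < n\<close> show ?thesis by (simp add: torus_char_def)
qed

lemma norm_diff_one_sq: "norm z = 1 \<Longrightarrow> (norm (z - 1))\<^sup>2 = 2 - 2 * Re z"
proof -
  assume "norm z = 1"
  then have "(Re z)\<^sup>2 + (Im z)\<^sup>2 = 1" using cmod_power2[of z] by simp
  then show ?thesis by (simp add: cmod_power2 power2_diff)
qed

text \<open>An odd power \<open>z\<close> of the root has \<open>z ^ r = -1\<close>, so it stays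
  away from 1; by the parallelogram law its midpoint with 1 lies inside the unit disc. That midpoint
  is the mean of a character over one bit of a cube vertex.\<close>

lemma half_sum_unity_root_power:
  assumes r: "r > 0" and k: "odd k"
  shows "(norm ((1 + unity_root (2 * r) ^ k) / 2)) \<le> 1 - 1 / (2 * (real r)\<^sup>2)"
proof -
  define z where "z = unity_root (2 * r) ^ k"
  have nz: "norm z = 1" by (simp add: z_def norm_power)
  have "z ^ r = (unity_root (2 * r) ^ r) ^ k" by (simp add: z_def power_mult[symmetric] mult.commute)
  then have zr: "z ^ r = -1" using k by (simp add: unity_root_half[OF r])
  \<comment> \<open>Telescoping from \<open>z ^ 0 = 1\<close> to \<open>z ^ r = - 1\<close>: some step, hence each, is at least \<open>2 / r\<close> long.\<close>
  have "2 = norm (z ^ r - 1 ^ r)" by (simp add: zr)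
  also have "\<dots> \<le> r * norm (z - 1)" using norm_power_diff[of z 1 r] nz by simp
  finally have "2 / r \<le> norm (z - 1)" using r by (simp add: field_simps)
  then have "(2 / r)\<^sup>2 \<le> (norm (z - 1))\<^sup>2" by (intro power_mono) auto
  moreover have "(norm (1 + z))\<^sup>2 + (norm (z - 1))\<^sup>2 = 4"
    using nz cmod_power2[of z] by (simp add: cmod_power2) (simp add: power2_eq_square algebra_simps)
  ultimately have "(norm ((1 + z) / 2))\<^sup>2 \<le> 1 - 1 / (real r)\<^sup>2"
    by (simp add: norm_divide power_divide)
  \<comment> \<open>Completing the square adds only the term
    \<open>1 / (4 * real r ^ 4)\<close>.\<close>
  also have "\<dots> \<le> (1 - 1 / (2 * (real r)\<^sup>2))\<^sup>2"
    by (simp add: power2_diff)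
  finally have "(norm ((1 + z) / 2))\<^sup>2 \<le> (1 - 1 / (2 * (real r)\<^sup>2))\<^sup>2" .
  moreover have "1 \<le> (real r)\<^sup>2" using r by simp
  then have "0 \<le> 1 - 1 / (2 * (real r)\<^sup>2)" by (simp add: divide_le_eq)
  ultimately show ?thesis unfolding z_def by (rule power2_le_imp_le)
qed

text \<open>Multiply by Bernoulli's \<open>1 + a * b \<le> (1 + b) ^ a\<close>: the product is at
  most \<open>(1 - b\<^sup>2) ^ a \<le> 1\<close>. On [0,1], \<open>1 / (1 + c)\<close> lies below
  its chord \<open>1 - c / 2\<close>.\<close>

lemma one_minus_power_bound:
  fixes b :: real
  assumes b: "0 \<le> b" "b \<le> 1" and o: "real a * b \<le> 1"
  shows "(1 - b) ^ a \<le> 1 - real a * b / 2"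
proof -
  have "(1 - b) ^ a * (1 + real a * b) \<le> (1 - b) ^ a * (1 + b) ^ a"
    using b Bernoulli_inequality[of b a] by (intro mult_left_mono) auto
  also have "\<dots> = (1 - b\<^sup>2) ^ a"
    by (simp only: power_mult_distrib[symmetric]) (simp add: algebra_simps power2_eq_square)
  also have "\<dots> \<le> 1" using b by (intro power_le_one) (auto simp: power_le_one)
  finally have "(1 - b) ^ a \<le> 1 / (1 + real a * b)"
    using b by (simp add: field_simps add_pos_nonneg)
  also have "\<dots> \<le> 1 - real a * b / 2"
  proof -
    define c where "c = real a * b"
    have c: "0 \<le> c" "c \<le> 1" using b o by (auto simp: c_def)
    have "(1 - c / 2) * (1 + c) - 1 = c * (1 - c) / 2" by (simp add: field_simps)
    also have "\<dots> \<ge> 0" using c by simp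
    finally show ?thesis unfolding c_def[symmetric] using c by (simp add: divide_le_eq)
  qed
  finally show ?thesis .
qed

text \<open>Both sides are governed by the set \<open>J\<close> of coordinates with odd frequency. A
  half-turn in coordinate \<open>j\<close> has character value 1 or -1 by the parity of
  \<open>k j\<close>, so the left side counts \<open>J\<close>. The mean over the cube factors into
  midpoints, each odd one contributing at most \<open>1 - b\<close>. The hypothesis on
  \<open>n\<close> keeps \<open>card J * b\<close> at most 1, the range in which these savings add
  up linearly.\<close>

lemma torus_multiplier_bound:
  assumes r: "r > 0" and n: "n \<le> 2 * r\<^sup>2"
  shows "2 ^ n * (\<Sum>j<n. (norm (torus_char n (2 * r) k (torus_axis j r) - 1))\<^sup>2) \<le>
    8 * (real r)\<^sup>2 * (\<Sum>e\<in>discrete_torus n 2. (norm (torus_char n (2 * r) k e - 1))\<^sup>2)"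
proof -
  let ?w = "unity_root (2 * r)" and ?T = "discrete_torus n 2"
  define J where "J = {j. j < n \<and> odd (k j)}"
  define b where "b = 1 / (2 * (real r)\<^sup>2)"
  have "J \<subseteq> {..<n}" by (auto simp: J_def)
  then have cJ: "card J \<le> n" using card_mono[of "{..<n}" J] by simp
  have r1: "1 \<le> (real r)\<^sup>2" using r by simp
  have b: "0 \<le> b" "b \<le> 1" using r1 by (auto simp: b_def divide_le_eq)
  have "real (card J) \<le> real (2 * r\<^sup>2)" using cJ n by linarith
  then have "real (card J) \<le> 2 * (real r)\<^sup>2" by simp
  then have o: "real (card J) * b \<le> 1" using r1 by (simp add: b_def divide_le_eq)
  have "(\<Sum>j<n. (norm (torus_char n (2 * r) k (torus_axis j r) - 1))\<^sup>2) = (\<Sum>j<n. if odd (k j) then 4 else 0)"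
  proof (intro sum.cong refl)
    fix j assume "j \<in> {..<n}"
    then have "torus_char n (2 * r) k (torus_axis j r) = (?w ^ r) ^ k j"
      by (simp add: torus_char_axis power_mult[symmetric] mult.commute)
    then show "(norm (torus_char n (2 * r) k (torus_axis j r) - 1))\<^sup>2 = (if odd (k j) then 4 else 0)"
      by (simp add: unity_root_half[OF r])
  qed
  also have "\<dots> = 4 * real (card J)"
    by (simp add: sum.If_cases J_def Int_def)
  finally have lhs: "(\<Sum>j<n. (norm (torus_char n (2 * r) k (torus_axis j r) - 1))\<^sup>2) = 4 * real (card J)" .
  have "(\<Sum>e\<in>?T. torus_char n (2 * r) k e) = (\<Prod>j<n. \<Sum>e<2. ?w ^ (k j * e))"
    unfolding torus_char_def discrete_torus_def by (subst prod_sum_PiE) auto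
  also have "\<dots> = (\<Prod>j<n. 2 * ((1 + ?w ^ k j) / 2))"
    by (intro prod.cong refl) (simp add: numeral_2_eq_2)
  also have "\<dots> = 2 ^ n * (\<Prod>j<n. (1 + ?w ^ k j) / 2)"
    by (simp only: prod.distrib prod_constant card_lessThan)
  finally have sumT: "(\<Sum>e\<in>?T. torus_char n (2 * r) k e) = 2 ^ n * (\<Prod>j<n. (1 + ?w ^ k j) / 2)" .
  have "Re (\<Prod>j<n. (1 + ?w ^ k j) / 2) \<le> norm (\<Prod>j<n. (1 + ?w ^ k j) / 2)"
    by (rule complex_Re_le_cmod)
  also have "\<dots> = (\<Prod>j<n. norm ((1 + ?w ^ k j) / 2))" by (rule prod_norm[symmetric])
  also have "\<dots> \<le> (\<Prod>j<n. if odd (k j) then 1 - b else 1)"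
  proof (intro prod_mono conjI)
    fix j
    show "norm ((1 + ?w ^ k j) / 2) \<le> (if odd (k j) then 1 - b else 1)"
    proof (cases "odd (k j)")
      case True then show ?thesis using half_sum_unity_root_power[OF r] by (simp add: b_def)
    next
      case False
      have "norm (1 + ?w ^ k j) \<le> 2" using norm_triangle_ineq[of 1 "?w ^ k j"] by (simp add: norm_power)
      then show ?thesis using False by (simp add: norm_divide)
    qed
  qed auto
  also have "\<dots> = (1 - b) ^ card J"
    by (simp add: prod.If_cases J_def Int_def)
  also have "\<dots> \<le> 1 - real (card J) * b / 2" by (rule one_minus_power_bound[OF b o])
  finally have Re: "Re (\<Prod>j<n. (1 + ?w ^ k j) / 2) \<le> 1 - real (card J) * b / 2" .
  \<comment> \<open>On the unit circle the squared distance to 1 is \<open>2 - 2 * Re z\<close>, so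
    a lower bound for this sum is an upper bound for the real part of the mean.\<close>
  have "(\<Sum>e\<in>?T. (norm (torus_char n (2 * r) k e - 1))\<^sup>2) = 2 * 2 ^ n - 2 * Re (\<Sum>e\<in>?T. torus_char n (2 * r) k e)"
    by (simp add: norm_diff_one_sq sum_subtractf sum_distrib_left card_discrete_torus)
  also have "\<dots> = 2 * 2 ^ n * (1 - Re (\<Prod>j<n. (1 + ?w ^ k j) / 2))"
  proof -
    have "Re (2 ^ n * z) = 2 ^ n * Re z" for z :: complex
      using Re_complex_of_real[of "2 ^ n"] Im_complex_of_real[of "2 ^ n"] by simp
    then show ?thesis unfolding sumT by (simp add: right_diff_distrib)
  qed
  also have "\<dots> \<ge> 2 * 2 ^ n * (real (card J) * b / 2)"
    using Re by (intro mult_left_mono) auto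
  finally have "2 ^ n * (real (card J) * b) \<le> (\<Sum>e\<in>?T. (norm (torus_char n (2 * r) k e - 1))\<^sup>2)" by simp
  then have "8 * (real r)\<^sup>2 * (2 ^ n * (real (card J) * b)) \<le>
      8 * (real r)\<^sup>2 * (\<Sum>e\<in>?T. (norm (torus_char n (2 * r) k e - 1))\<^sup>2)"
    by (intro mult_left_mono) auto
  moreover have "8 * (real r)\<^sup>2 * (2 ^ n * (real (card J) * b)) = 2 ^ n * (4 * real (card J))"
    using r by (simp add: b_def)
  ultimately show ?thesis unfolding lhs by linarith
qed

text \<open>Weight the multiplier bound by the squared Fourier coefficients of \<open>f\<close> and
  sum over the frequencies; the factor \<open>(2 * r) ^ n\<close> cancels.\<close>

lemma torus_cotype_complex:
  fixes f :: "(nat \<Rightarrow> nat) \<Rightarrow> complex"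
  assumes r: "r > 0" and n: "n \<le> 2 * r\<^sup>2"
  shows "2 ^ n * (\<Sum>j<n. \<Sum>x\<in>discrete_torus n (2 * r).
      (norm (f (torus_shift n (2 * r) (torus_axis j r) x) - f x))\<^sup>2) \<le>
    8 * (real r)\<^sup>2 * (\<Sum>e\<in>discrete_torus n 2. \<Sum>x\<in>discrete_torus n (2 * r).
      (norm (f (torus_shift n (2 * r) e x) - f x))\<^sup>2)"
proof -
  let ?m = "2 * r" and ?T = "discrete_torus n (2 * r)" and ?E = "discrete_torus n 2"
  let ?en = "\<lambda>v. \<Sum>x\<in>?T. (norm (f (torus_shift n ?m v x) - f x))\<^sup>2"
  let ?c = "\<lambda>k. (norm (torus_fourier n ?m f k))\<^sup>2"
  let ?d = "\<lambda>k v. (norm (torus_char n ?m k v - 1))\<^sup>2"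
  have m: "?m > 0" using r by simp
  \<comment> \<open>Generic in the index type, to cover both the half-turns
    \<open>torus_axis j r\<close> and the cube vertices.\<close>
  have en: "real (?m ^ n) * (\<Sum>v\<in>V. ?en (g v)) = (\<Sum>k\<in>?T. ?c k * (\<Sum>v\<in>V. ?d k (g v)))" for V :: "'b set" and g
  proof -
    have "real (?m ^ n) * (\<Sum>v\<in>V. ?en (g v)) = (\<Sum>v\<in>V. \<Sum>k\<in>?T. ?c k * ?d k (g v))"
      unfolding torus_shift_energy[OF m, symmetric] by (rule sum_distrib_left)
    then show ?thesis unfolding sum_distrib_left by (subst (2) sum.swap)
  qed
  have pull: "a * (\<Sum>k\<in>?T. ?c k * D k) = (\<Sum>k\<in>?T. ?c k * (a * D k))" for a D
    by (simp add: sum_distrib_left mult.left_commute)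
  have "real (?m ^ n) * (2 ^ n * (\<Sum>j<n. ?en (torus_axis j r))) =
      (\<Sum>k\<in>?T. ?c k * (2 ^ n * (\<Sum>j<n. ?d k (torus_axis j r))))"
    unfolding pull[symmetric] en[symmetric] by (rule mult.left_commute)
  also have "\<dots> \<le> (\<Sum>k\<in>?T. ?c k * (8 * (real r)\<^sup>2 * (\<Sum>e\<in>?E. ?d k e)))"
    by (intro sum_mono mult_left_mono torus_multiplier_bound r n) auto
  also have "\<dots> = real (?m ^ n) * (8 * (real r)\<^sup>2 * (\<Sum>e\<in>?E. ?en e))"
    unfolding pull[symmetric] en[symmetric] by (rule mult.left_commute)
  finally show ?thesis using m by (simp add: mult_le_cancel_left_pos)
qed

section \<open>The cotype inequality in sequence spaces\<close>

lemma norm_cis_minus_one_le_2: "norm (cis t - 1) \<le> 2"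
  using norm_triangle_ineq4[of "cis t" 1] by simp

lemma norm_cis_minus_cis: "norm (cis (t * a) - cis (t * b)) = norm (cis (t * (a - b)) - 1)"
proof -
  have "cis (t * a) - cis (t * b) = cis (t * b) * (cis (t * (a - b)) - 1)"
    by (simp add: algebra_simps cis_mult)
  then show ?thesis by (simp add: norm_mult)
qed

section \<open>Integral representation of the \<open>p\<close>-th power of the absolute
  value\<close>

lemma norm_cis_uminus_minus_one: "norm (cis (- t) - 1) = norm (cis t - 1)"
  by (metis complex_cnj_diff complex_cnj_one complex_mod_cnj cis_cnj)

text \<open>The squared norm is \<open>2 - 2 * cos (t * s)\<close>, so up to a constant this is the
  Levy-Khintchine integrand of the symmetric \<open>p\<close>-stable law, on the positive half-line.
  Values in \<open>ennreal\<close> leave finiteness of the integral to a separate argument.\<close>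

definition levy_kernel :: "real \<Rightarrow> real \<Rightarrow> real \<Rightarrow> ennreal" where
  "levy_kernel p s t = ennreal ((norm (cis (t * s) - 1))\<^sup>2 * t powr (-1 - p)) * indicator {0<..} t"

lemma borel_measurable_levy_kernel [measurable]: "levy_kernel p s \<in> borel_measurable borel"
proof -
  have [measurable]: "cis \<in> borel_measurable borel"
    by (intro borel_measurable_continuous_onI continuous_intros)
  show ?thesis unfolding levy_kernel_def by measurable
qed

text \<open>A common factor to be cancelled from both sides of an inequality; for this it is shown
  to be finite and nonzero.\<close>

definition levy_const :: "real \<Rightarrow> ennreal" where
  "levy_const p = (\<integral>\<^sup>+t. levy_kernel p 1 t \<partial>lborel)"

text \<open>Substituting \<open>s * t\<close> for \<open>t\<close> brings out \<open>s\<close> from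
  the Jacobian and \<open>s powr (-1 - p)\<close> from the weight, hence homogeneity of degree
  \<open>p\<close>.\<close>

lemma nn_integral_levy_kernel_pos:
  assumes s: "s > 0"
  shows "(\<integral>\<^sup>+t. levy_kernel p s t \<partial>lborel) = levy_const p * ennreal (s powr p)"
proof -
  have "levy_kernel p 1 (s * t) = ennreal (s powr (-1 - p)) * levy_kernel p s t" for t
  proof (cases "t > 0")
    case True
    then show ?thesis using s
      by (simp add: levy_kernel_def powr_mult ennreal_mult[symmetric] mult_ac)
  next
    case False
    then have "\<not> s * t > 0" using s by (simp add: zero_less_mult_iff)
    then show ?thesis using False by (simp add: levy_kernel_def)
  qed
  then have "levy_const p = ennreal s * (ennreal (s powr (-1 - p)) * (\<integral>\<^sup>+t. levy_kernel p s t \<partial>lborel))"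
    unfolding levy_const_def using nn_integral_real_affine[of "levy_kernel p 1" s 0] s
    by (simp add: nn_integral_cmult)
  then have "levy_const p * ennreal (s powr p) =
      ennreal (s * s powr (-1 - p) * s powr p) * (\<integral>\<^sup>+t. levy_kernel p s t \<partial>lborel)"
    using s by (simp add: ennreal_mult mult_ac)
  also have "s * s powr (-1 - p) * s powr p = s powr 1 * s powr (-1 - p) * s powr p"
    using s by simp
  also have "\<dots> = 1"
    unfolding powr_add[symmetric] using s by simp
  finally show ?thesis by simp
qed

lemma nn_integral_levy_kernel:
  "(\<integral>\<^sup>+t. levy_kernel p s t \<partial>lborel) = levy_const p * ennreal (\<bar>s\<bar> powr p)"
proof -
  have *: "levy_kernel p s = levy_kernel p \<bar>s\<bar>"
    using norm_cis_uminus_minus_one by (auto simp: levy_kernel_def fun_eq_iff abs_if)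
  show ?thesis
  proof (cases "s = 0")
    case True
    then show ?thesis by (simp add: levy_kernel_def)
  next
    case False
    then show ?thesis unfolding * by (intro nn_integral_levy_kernel_pos) simp
  qed
qed

text \<open>Near 0 the kernel is at most \<open>t powr (1 - p)\<close>, integrable since
  \<open>p < 2\<close>; beyond 1 it is at most \<open>4 * t powr (-1 - p)\<close>, integrable since
  \<open>p > 0\<close>.\<close>

lemma levy_const_finite:
  assumes p: "0 < p" "p < 2"
  shows "levy_const p \<noteq> top"
proof -
  have 1: "(\<integral>\<^sup>+t. ennreal (t powr (1 - p)) * indicator {0..1} t \<partial>lborel) < top"
    using nn_integral_has_integral_lebesgue'[OF _ has_integral_powr_from_0[of "1 - p" 1]] p by simp
  have 2: "(\<integral>\<^sup>+t. ennreal (t powr (-1 - p)) * indicator {1..} t \<partial>lborel) < top"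
    using nn_integral_has_integral_lebesgue'[OF _ has_integral_powr_to_inf[of "-1 - p" 1]] p by simp
  have "levy_const p \<le> (\<integral>\<^sup>+t. ennreal (t powr (1 - p)) * indicator {0..1} t +
      4 * (ennreal (t powr (-1 - p)) * indicator {1..} t) \<partial>lborel)"
    unfolding levy_const_def
  proof (rule nn_integral_mono)
    fix t :: real
    consider "t \<le> 0" | "0 < t" "t \<le> 1" | "1 < t" by linarith
    then show "levy_kernel p 1 t \<le> ennreal (t powr (1 - p)) * indicator {0..1} t +
      4 * (ennreal (t powr (-1 - p)) * indicator {1..} t)"
    proof cases
      case 1 then show ?thesis by (simp add: levy_kernel_def)
    next
      case 2
      have "(norm (cis t - 1))\<^sup>2 * t powr (-1 - p) \<le> t\<^sup>2 * t powr (-1 - p)"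
        using norm_cis_minus_one_le[of t] 2 by (intro mult_right_mono power_mono) auto
      also have "\<dots> = t powr 2 * t powr (-1 - p)" using 2 by (simp add: powr_numeral)
      also have "\<dots> = t powr (1 - p)" unfolding powr_add[symmetric] by simp
      finally have "levy_kernel p 1 t \<le> ennreal (t powr (1 - p)) * indicator {0..1} t"
        using 2 by (simp add: levy_kernel_def ennreal_leI)
      then show ?thesis by (rule order_trans) simp
    next
      case 3
      have "(norm (cis t - 1))\<^sup>2 \<le> 2\<^sup>2"
        by (intro power_mono norm_cis_minus_one_le_2) simp
      then have "(norm (cis t - 1))\<^sup>2 * t powr (-1 - p) \<le> 4 * t powr (-1 - p)"
        by (intro mult_right_mono) auto
      then have "levy_kernel p 1 t \<le> ennreal (4 * t powr (-1 - p))"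
        using 3 by (simp add: levy_kernel_def ennreal_leI)
      then show ?thesis using 3 by (simp add: ennreal_mult)
    qed
  qed
  also have "\<dots> < top"
    using 1 2 by (subst nn_integral_add, simp, simp, subst nn_integral_cmult, simp)
      (simp add: ennreal_mult_less_top)
  finally show ?thesis by simp
qed

text \<open>On [1,2] the sine is positive, so the kernel is positive on a set of positive
  measure.\<close>

lemma levy_const_nonzero: "levy_const p \<noteq> 0"
proof
  assume "levy_const p = 0"
  then have "AE t in lborel. levy_kernel p 1 t = 0"
    unfolding levy_const_def by (subst (asm) nn_integral_0_iff_AE) auto
  then have "AE t in lborel. t \<notin> {1..2::real}"
  proof (rule AE_mp, intro AE_I2 impI notI)
    fix t :: real assume 0: "levy_kernel p 1 t = 0" and t: "t \<in> {1..2}"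
    then have "(norm (cis t - 1))\<^sup>2 * t powr (-1 - p) \<le> 0"
      by (simp add: levy_kernel_def)
    then have "cis t = 1" using t by (simp add: mult_le_0_iff)
    then have "sin t = 0" by (metis cis.sel(2) one_complex.sel(2))
    moreover have "sin t > 0" using t pi_gt3 by (intro sin_gt_zero) auto
    ultimately show False by simp
  qed
  then have "emeasure lborel {1..2::real} = 0"
    by (subst (asm) AE_iff_null_sets[symmetric]) auto
  then show False by (simp add: emeasure_lborel_Icc del: emeasure_lborel_Icc_eq)
qed

text \<open>For \<open>p < 2\<close>, apply the complex inequality to \<open>cis (t * g x)\<close>
  for each \<open>t\<close>, integrate against the Levy weight and cancel \<open>levy_const\<close>.
  At \<open>p = 2\<close> that integral diverges, but the complex inequality applies to
  \<open>g\<close> itself.\<close>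

lemma torus_cotype_real:
  fixes g :: "(nat \<Rightarrow> nat) \<Rightarrow> real"
  assumes r: "r > 0" and n: "n \<le> 2 * r\<^sup>2" and p: "0 < p" "p \<le> 2"
  shows "2 ^ n * (\<Sum>j<n. \<Sum>x\<in>discrete_torus n (2 * r).
      \<bar>g (torus_shift n (2 * r) (torus_axis j r) x) - g x\<bar> powr p) \<le>
    8 * (real r)\<^sup>2 * (\<Sum>e\<in>discrete_torus n 2. \<Sum>x\<in>discrete_torus n (2 * r).
      \<bar>g (torus_shift n (2 * r) e x) - g x\<bar> powr p)"
proof (cases "p = 2")
  case True
  have "norm (complex_of_real a - complex_of_real b) = \<bar>a - b\<bar>" for a b
    by (metis norm_of_real of_real_diff)
  moreover have "\<bar>a\<bar> powr p = \<bar>a\<bar>\<^sup>2" for a :: real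
    unfolding True by (simp add: powr_numeral)
  ultimately show ?thesis
    using torus_cotype_complex[OF r n, of "\<lambda>x. complex_of_real (g x)"] by simp
next
  case False
  then have p2: "p < 2" using p by simp
  let ?T = "discrete_torus n (2 * r)" and ?E = "discrete_torus n 2"
  define d where "d v x = g (torus_shift n (2 * r) v x) - g x" for v x
  \<comment> \<open>Takes weight and indicator out of the sums, so that the inequality for fixed
    \<open>t\<close> has only to be multiplied by them.\<close>
  have kernel_sum: "(\<Sum>v\<in>V. \<Sum>x\<in>?T. levy_kernel p (d (h v) x) t) =
      ennreal ((\<Sum>v\<in>V. \<Sum>x\<in>?T. (norm (cis (t * d (h v) x) - 1))\<^sup>2) * t powr (-1 - p)) * indicator {0<..} t"
    for V :: "'b set" and h t
    by (simp add: levy_kernel_def sum_distrib_right[symmetric] sum_ennreal sum_nonneg)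
  have integral_sum: "(\<integral>\<^sup>+t. ennreal c * (\<Sum>v\<in>V. \<Sum>x\<in>?T. levy_kernel p (d (h v) x) t) \<partial>lborel) =
      levy_const p * ennreal (c * (\<Sum>v\<in>V. \<Sum>x\<in>?T. \<bar>d (h v) x\<bar> powr p))"
    if "c \<ge> 0" for V :: "'b set" and h c
    using that
    by (simp add: nn_integral_cmult nn_integral_sum nn_integral_levy_kernel sum_distrib_left[symmetric]
        sum_ennreal sum_nonneg ennreal_mult mult.left_commute)
  have "levy_const p * ennreal (2 ^ n * (\<Sum>j<n. \<Sum>x\<in>?T. \<bar>d (torus_axis j r) x\<bar> powr p)) \<le>
      levy_const p * ennreal (8 * (real r)\<^sup>2 * (\<Sum>e\<in>?E. \<Sum>x\<in>?T. \<bar>d e x\<bar> powr p))"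
  proof (subst (1 2) integral_sum[symmetric], simp, simp, rule nn_integral_mono)
    fix t :: real
    have "2 ^ n * (\<Sum>j<n. \<Sum>x\<in>?T. (norm (cis (t * d (torus_axis j r) x) - 1))\<^sup>2) \<le>
        8 * (real r)\<^sup>2 * (\<Sum>e\<in>?E. \<Sum>x\<in>?T. (norm (cis (t * d e x) - 1))\<^sup>2)"
      using torus_cotype_complex[OF r n, of "\<lambda>x. cis (t * g x)"]
      unfolding norm_cis_minus_cis d_def .
    then have "2 ^ n * (\<Sum>j<n. \<Sum>x\<in>?T. (norm (cis (t * d (torus_axis j r) x) - 1))\<^sup>2) * t powr (-1 - p) \<le>
        8 * (real r)\<^sup>2 * (\<Sum>e\<in>?E. \<Sum>x\<in>?T. (norm (cis (t * d e x) - 1))\<^sup>2) * t powr (-1 - p)"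
      by (intro mult_right_mono) auto
    then show "ennreal (2 ^ n) * (\<Sum>j<n. \<Sum>x\<in>?T. levy_kernel p (d (torus_axis j r) x) t) \<le>
        ennreal (8 * (real r)\<^sup>2) * (\<Sum>e\<in>?E. \<Sum>x\<in>?T. levy_kernel p (d e x) t)"
      unfolding kernel_sum mult.assoc[symmetric]
      by (intro mult_right_mono) (simp_all add: ennreal_mult[symmetric] sum_nonneg mult.assoc ennreal_leI)
  qed
  then show ?thesis
    using levy_const_finite[OF p(1) p2] levy_const_nonzero[of p]
    by (simp add: ennreal_mult_le_mult_iff d_def sum_nonneg)
qed

text \<open>The \<open>p\<close>-th power of the norm is a sum over coordinates, so the scalar
  inequality is applied to each coordinate and summed.\<close>

lemma torus_cotype_lp:
  fixes F :: "(nat \<Rightarrow> nat) \<Rightarrow> nat \<Rightarrow> real"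
  assumes r: "r > 0" and n: "n \<le> 2 * r\<^sup>2" and p: "1 \<le> p" "p \<le> 2"
    and F: "\<And>x. x \<in> discrete_torus n (2 * r) \<Longrightarrow> F x \<in> lp_space p"
  shows "2 ^ n * (\<Sum>j<n. \<Sum>x\<in>discrete_torus n (2 * r).
      lp_norm p (\<lambda>i. F (torus_shift n (2 * r) (torus_axis j r) x) i - F x i) powr p) \<le>
    8 * (real r)\<^sup>2 * (\<Sum>e\<in>discrete_torus n 2. \<Sum>x\<in>discrete_torus n (2 * r).
      lp_norm p (\<lambda>i. F (torus_shift n (2 * r) e x) i - F x i) powr p)"
proof -
  let ?T = "discrete_torus n (2 * r)" and ?E = "discrete_torus n 2"
  define d where "d v x = (\<lambda>i. \<bar>F (torus_shift n (2 * r) v x) i - F x i\<bar> powr p)" for v x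
  have sd: "summable (d v x)" if "x \<in> ?T" for v x
  proof -
    have "(\<lambda>i. F (torus_shift n (2 * r) v x) i - F x i) \<in> lp_space p"
      using orlicz_space_diff[OF orlicz_function_powr[OF p(1)]] F that r
      unfolding orlicz_space_powr[OF p(1)] by simp
    then show ?thesis unfolding d_def lp_space_def by simp
  qed
  have norm_d: "lp_norm p (\<lambda>i. F (torus_shift n (2 * r) v x) i - F x i) powr p = suminf (d v x)"
    if "x \<in> ?T" for v x
    using p suminf_nonneg[OF sd[OF that, of v]]
    by (simp add: lp_norm_def powr_powr d_def)
  have "(\<Sum>i. 2 ^ n * (\<Sum>j<n. \<Sum>x\<in>?T. d (torus_axis j r) x i)) \<le>
      (\<Sum>i. 8 * (real r)\<^sup>2 * (\<Sum>e\<in>?E. \<Sum>x\<in>?T. d e x i))"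
    unfolding d_def
    by (intro suminf_le torus_cotype_real[OF r n] summable_mult summable_sum sd[unfolded d_def]) (use p in auto)
  then have "2 ^ n * (\<Sum>j<n. \<Sum>x\<in>?T. suminf (d (torus_axis j r) x)) \<le>
      8 * (real r)\<^sup>2 * (\<Sum>e\<in>?E. \<Sum>x\<in>?T. suminf (d e x))"
    by (simp add: suminf_mult suminf_sum summable_sum sd)
  then show ?thesis by (simp add: norm_d)
qed

text \<open>There are \<open>n = 2 * r\<^sup>2\<close> half-turns against the factor
  \<open>8 * r\<^sup>2\<close>, so \<open>A powr p \<le> 4 * B powr p\<close>, and
  \<open>4 \<le> 4 powr p\<close> since \<open>p \<ge> 1\<close>. The resulting constant is
  independent of \<open>r\<close>.\<close>

lemma torus_lp_distance_bound:
  fixes F :: "(nat \<Rightarrow> nat) \<Rightarrow> nat \<Rightarrow> real"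
  assumes r: "r > 0" and n: "n = 2 * r\<^sup>2" and p: "1 \<le> p" "p \<le> 2" and A: "A \<ge> 0" and B: "B \<ge> 0"
    and F: "\<And>x. x \<in> discrete_torus n (2 * r) \<Longrightarrow> F x \<in> lp_space p"
    and far: "\<And>x j. x \<in> discrete_torus n (2 * r) \<Longrightarrow> j < n \<Longrightarrow>
      A \<le> lp_norm p (\<lambda>i. F (torus_shift n (2 * r) (torus_axis j r) x) i - F x i)"
    and near: "\<And>x e. x \<in> discrete_torus n (2 * r) \<Longrightarrow> e \<in> discrete_torus n 2 \<Longrightarrow>
      lp_norm p (\<lambda>i. F (torus_shift n (2 * r) e x) i - F x i) \<le> B"
  shows "A \<le> 4 * B"
proof -
  let ?T = "discrete_torus n (2 * r)" and ?E = "discrete_torus n 2"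
  have "2 ^ n * (\<Sum>j<n. \<Sum>x\<in>?T. A powr p) \<le> 2 ^ n * (\<Sum>j<n. \<Sum>x\<in>?T.
      lp_norm p (\<lambda>i. F (torus_shift n (2 * r) (torus_axis j r) x) i - F x i) powr p)"
    using A p far by (intro mult_left_mono sum_mono powr_mono2) auto
  also have "\<dots> \<le> 8 * (real r)\<^sup>2 * (\<Sum>e\<in>?E. \<Sum>x\<in>?T.
      lp_norm p (\<lambda>i. F (torus_shift n (2 * r) e x) i - F x i) powr p)"
    using n by (intro torus_cotype_lp r p F) auto
  also have "\<dots> \<le> 8 * (real r)\<^sup>2 * (\<Sum>e\<in>?E. \<Sum>x\<in>?T. B powr p)"
    using p near by (intro mult_left_mono sum_mono powr_mono2) (auto simp: lp_norm_def)
  finally have "A powr p \<le> 4 * B powr p"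
    using r by (simp add: card_discrete_torus n)
  also have "\<dots> \<le> 4 powr p * B powr p"
    using p powr_mono[of 1 p 4] by (intro mult_right_mono) auto
  also have "\<dots> = (4 * B) powr p" using B by (simp add: powr_mult)
  finally show ?thesis
    using p B A powr_less_mono2[of p "4 * B" A] by linarith
qed

section \<open>The Orlicz function\<close>

text \<open>The continuation beyond 1 is the tangent line there, with value 1 and slope 3. With the
  value 0 on the negative axis the function is differentiable on the whole line, so convexity
  reduces to monotonicity of the derivative.\<close>

definition damped_square :: "real \<Rightarrow> real" where
  "damped_square t =
    (if t \<le> 0 then 0 else if t \<le> 1 then t\<^sup>2 / (1 - ln t) else 3 * t - 2)"

text \<open>Since \<open>inverse (1 - ln t)\<close> increases on (0,1], this form builds the
  derivative from nonnegative increasing terms.\<close>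

definition damped_square_deriv :: "real \<Rightarrow> real" where
  "damped_square_deriv t =
    (if t \<le> 0 then 0 else if t \<le> 1 then t * (2 * inverse (1 - ln t) + (inverse (1 - ln t))\<^sup>2) else 3)"

lemma damped_square_bounds:
  assumes "\<bar>t\<bar> \<le> 1" shows "0 \<le> damped_square t" "damped_square t \<le> t\<^sup>2"
proof -
  have "0 \<le> damped_square t \<and> damped_square t \<le> t\<^sup>2"
  proof (cases "t > 0")
    case True
    then have "ln t \<le> 0" using assms by simp
    then have "0 \<le> t\<^sup>2 / (1 - ln t)" "t\<^sup>2 / (1 - ln t) \<le> t\<^sup>2 / 1"
      by (intro divide_nonneg_nonneg divide_left_mono; simp)+
    then show ?thesis using True assms by (simp add: damped_square_def)
  qed (simp add: damped_square_def)
  then show "0 \<le> damped_square t" "damped_square t \<le> t\<^sup>2" by blast+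
qed

lemma log_quotient_deriv:
  assumes "0 < t" "t \<le> 1"
  shows "((\<lambda>t. t\<^sup>2 / (1 - ln t)) has_real_derivative damped_square_deriv t) (at t within S)"
proof -
  define D where "D = 1 - ln t"
  have D: "D \<noteq> 0" using assms ln_le_zero_iff[of t] unfolding D_def by linarith
  have "((\<lambda>t. t\<^sup>2 / (1 - ln t)) has_real_derivative
      ((2 * t) * D - t\<^sup>2 * (- (1 / t))) / (D * D)) (at t within S)"
    unfolding D_def using assms D[unfolded D_def] by (auto intro!: derivative_eq_intros)
  also have "((2 * t) * D - t\<^sup>2 * (- (1 / t))) / (D * D) = damped_square_deriv t"
    using assms D by (simp add: damped_square_deriv_def D_def[symmetric] field_simps power2_eq_square)
  finally show ?thesis .
qed

text \<open>Two-sided differentiability also at the seams 0 and 1 lets the global derivative tests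
  yield continuity, monotonicity and convexity.\<close>

lemma damped_square_has_deriv:
  "(damped_square has_real_derivative damped_square_deriv t) (at t)"
proof -
  consider "t < 0" | "t = 0" | "0 < t" "t < 1" | "t = 1" | "1 < t" by linarith
  then show ?thesis
  proof cases
    case 1
    have "((\<lambda>_. 0) has_real_derivative damped_square_deriv t) (at t)"
      using 1 by (simp add: damped_square_deriv_def)
    then show ?thesis
      by (rule has_field_derivative_transform_within_open[of _ _ _ "{..<0}"])
        (use 1 in \<open>auto simp: damped_square_def\<close>)
  next
    case 2
    \<comment> \<open>Comparison with \<open>h\<^sup>2\<close> bounds the difference quotient by
      \<open>\<bar>h\<bar>\<close> on both sides of 0.\<close>
    have "((\<lambda>h. damped_square h / h) \<longlongrightarrow> 0) (at 0)"
    proof (rule Lim_null_comparison)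
      show "\<forall>\<^sub>F h in at 0. norm (damped_square h / h) \<le> \<bar>h\<bar>"
        unfolding eventually_at
      proof (intro exI[of _ 1] conjI ballI impI)
        fix h :: real assume h: "h \<noteq> 0 \<and> dist h 0 < 1"
        then have "\<bar>damped_square h\<bar> \<le> \<bar>h\<bar> * \<bar>h\<bar>"
          using damped_square_bounds[of h] by (simp add: power2_eq_square dist_real_def)
        then show "norm (damped_square h / h) \<le> \<bar>h\<bar>"
          using h by (simp add: divide_le_eq)
      qed simp
      show "((\<lambda>h::real. \<bar>h\<bar>) \<longlongrightarrow> 0) (at 0)" by (intro tendsto_rabs_zero tendsto_ident_at)
    qed
    then show ?thesis
      using 2 by (simp add: has_field_derivative_iff damped_square_deriv_def damped_square_def)
  next
    case 3
    then show ?thesis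
      by (intro has_field_derivative_transform_within_open[OF log_quotient_deriv, of t "{0<..<1}"])
        (auto simp: damped_square_def)
  next
    case 4
    \<comment> \<open>At the seam 1 the two formulas give one-sided derivatives, both equal to
      3.\<close>
    have l: "((\<lambda>y. (damped_square y - damped_square 1) / (y - 1)) \<longlongrightarrow> 3) (at_left 1)"
    proof (rule Lim_transform_within[where d = 1])
      show "((\<lambda>y. (y\<^sup>2 / (1 - ln y) - 1\<^sup>2 / (1 - ln 1)) / (y - 1)) \<longlongrightarrow> 3) (at_left (1::real))"
        using log_quotient_deriv[of 1 "{..<1}"]
        unfolding has_field_derivative_iff by (simp add: damped_square_deriv_def)
    qed (auto simp: damped_square_def dist_real_def)
    have r: "((\<lambda>y. (damped_square y - damped_square 1) / (y - 1)) \<longlongrightarrow> 3) (at_right 1)"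
    proof (rule Lim_transform_within[where d = 1])
      show "((\<lambda>y. 3) \<longlongrightarrow> 3) (at_right (1::real))" by simp
    qed (auto simp: damped_square_def dist_real_def field_simps)
    from filterlim_split_at[OF l r] show ?thesis
      using 4 by (simp add: has_field_derivative_iff damped_square_deriv_def)
  next
    case 5
    have "((\<lambda>t. 3 * t - 2) has_real_derivative damped_square_deriv t) (at t)"
      using 5 by (auto intro!: derivative_eq_intros simp: damped_square_deriv_def)
    then show ?thesis
      by (rule has_field_derivative_transform_within_open[of _ _ _ "{1<..}"])
        (use 5 in \<open>auto simp: damped_square_def\<close>)
  qed
qed

lemma damped_square_deriv_mono:
  assumes "s \<le> t" shows "damped_square_deriv s \<le> damped_square_deriv t"
proof -
  define D where "D t = t * (2 * inverse (1 - ln t) + (inverse (1 - ln t))\<^sup>2)" for t :: real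
  have D: "0 \<le> D a" "D a \<le> D b" if "0 < a" "a \<le> b" "b \<le> 1" for a b
  proof -
    have "1 \<le> 1 - ln b" "1 - ln b \<le> 1 - ln a" using that by auto
    then have "inverse (1 - ln a) \<le> inverse (1 - ln b)" "0 \<le> inverse (1 - ln a)"
      by (auto intro!: le_imp_inverse_le)
    then show "0 \<le> D a" "D a \<le> D b"
      unfolding D_def using that by (auto intro!: mult_mono add_mono power_mono)
  qed
  \<comment> \<open>The instance \<open>t t\<close> gives nonnegativity when
    \<open>s \<le> 0 < t \<le> 1\<close>; the instance \<open>s 1\<close> compares with the slope
    \<open>D 1 = 3\<close> when \<open>t > 1\<close>.\<close>
  show ?thesis
    using assms D[of s t] D[of t t] D[of s 1]
    by (auto simp: damped_square_deriv_def D_def[symmetric]) (simp add: D_def)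
qed

lemma orlicz_damped_square: "orlicz_function damped_square"
proof -
  have cont: "continuous_on {0..} damped_square"
    using damped_square_has_deriv DERIV_isCont by (blast intro: continuous_at_imp_continuous_on)
  \<comment> \<open>The point \<open>min t 0\<close> is not above \<open>t\<close>, and the
    derivative vanishes there.\<close>
  have "damped_square_deriv t \<ge> 0" for t
    using damped_square_deriv_mono[of "min t 0" t] by (simp add: damped_square_deriv_def split: if_splits)
  then have mono: "damped_square s \<le> damped_square t" if "s \<le> t" for s t
    using damped_square_has_deriv that by (blast intro: DERIV_nonneg_imp_nondecreasing)
  have nonneg: "damped_square t \<ge> 0" for t
    using mono[of "min t 0" t] by (simp add: damped_square_def split: if_splits)
  have "convex_on {0..} damped_square"
    using damped_square_has_deriv damped_square_deriv_mono
    by (intro convex_on_realI[where f' = damped_square_deriv]) auto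
  moreover have "filterlim (\<lambda>t::real. 3 * t - 2) at_top at_top" by real_asymp
  then have "filterlim damped_square at_top at_top"
    by (rule filterlim_mono_eventually[OF _ order_refl order_refl])
      (auto simp: damped_square_def eventually_at_top_linorder intro!: exI[of _ 2])
  ultimately show ?thesis
    using cont mono nonneg
    by (auto simp: orlicz_function_def mono_on_def) (simp add: damped_square_def)
qed

lemma nondegenerate_damped_square: "nondegenerate damped_square"
proof -
  have "damped_square t > 0" if "t > 0" for t
  proof (cases "t \<le> 1")
    case True
    then have "ln t \<le> 0" using that by simp
    then have "1 - ln t > 0" by linarith
    then show ?thesis using that True by (simp add: damped_square_def)
  qed (use that in \<open>simp add: damped_square_def\<close>)
  then show ?thesis by (simp add: nondegenerate_def)
qed

text \<open>The threshold 1 is the bound in the definition of the norm; this makes the norm dominate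
  each coordinate with constant 1.\<close>

lemma damped_square_gt_1: "t > 1 \<Longrightarrow> damped_square t > 1"
  by (simp add: damped_square_def)

section \<open>The Matuszewska-Orlicz indices\<close>

lemma damped_square_ratio:
  assumes l: "0 < l" "l \<le> 1" and t: "0 < t" "t \<le> 1"
  shows "damped_square (l * t) / (damped_square l * t powr q) =
    t powr (2 - q) * ((1 - ln l) / (1 - ln l - ln t))"
proof -
  have lt: "\<not> l * t \<le> 0" "l * t \<le> 1" using assms by (auto simp: not_le intro: mult_le_one)
  have "damped_square (l * t) / (damped_square l * t powr q) =
      (t\<^sup>2 / t powr q) * ((1 - ln l) / (1 - ln l - ln t))"
    using assms lt by (simp add: damped_square_def ln_mult power_mult_distrib diff_diff_eq)
  also have "t\<^sup>2 / t powr q = t powr (2 - q)"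
    using t by (simp add: powr_diff powr_numeral)
  finally show ?thesis .
qed

text \<open>The quotient is \<open>t powr (2 - q)\<close> times a logarithmic factor in (0,1]. For
  \<open>q \<le> 2\<close> it is at most 1; for \<open>q > 2\<close>, already at
  \<open>l = 1\<close>, the power beats the logarithm as \<open>t\<close> tends to 0.\<close>

lemma lower_index_damped_square: "lower_index damped_square = 2"
proof -
  let ?I = "{0<..1::real} \<times> {0<..1::real}"
  let ?S = "\<lambda>q. SUP (l, t) \<in> ?I. ereal (damped_square (l * t) / (damped_square l * t powr q))"
  have "(?S q < \<infinity>) \<longleftrightarrow> q \<le> 2" for q
  proof
    assume q: "q \<le> 2"
    have "?S q \<le> 1"
    proof (rule SUP_least, clarify)
      fix l t :: real assume lt: "l \<in> {0<..1}" "t \<in> {0<..1}"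
      then have "ln l \<le> 0" "ln t \<le> 0" by auto
      then have "(1 - ln l) / (1 - ln l - ln t) \<le> 1" "(1 - ln l) / (1 - ln l - ln t) \<ge> 0"
        by (auto simp: divide_le_eq_1)
      moreover have "t powr (2 - q) \<le> 1" using lt q by (intro powr_le1) auto
      ultimately have "t powr (2 - q) * ((1 - ln l) / (1 - ln l - ln t)) \<le> 1"
        by (intro mult_le_one) auto
      then show "ereal (damped_square (l * t) / (damped_square l * t powr q)) \<le> 1"
        using lt by (simp add: damped_square_ratio)
    qed
    then show "?S q < \<infinity>" by (rule le_less_trans) simp
  next
    assume S: "?S q < \<infinity>"
    show "q \<le> 2"
    proof (rule ccontr)
      assume "\<not> q \<le> 2"
      then have q: "q > 2" by simp
      obtain C where C: "?S q \<le> ereal C"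
        using S by (cases "?S q") auto
      have le: "t powr (2 - q) / (1 - ln t) \<le> C" if "0 < t" "t \<le> 1" for t
      proof -
        have "ereal (damped_square (1 * t) / (damped_square 1 * t powr q)) \<le> ?S q"
          by (rule SUP_upper2[of "(1, t)"]) (use that in auto)
        also note C
        finally show ?thesis using that by (simp only: damped_square_ratio[of 1 t q]) simp
      qed
      have "filterlim (\<lambda>t. t powr (2 - q) / (1 - ln t)) at_top (at_right 0)"
        using q by real_asymp
      then have "eventually (\<lambda>t. t powr (2 - q) / (1 - ln t) > C) (at_right 0)"
        by (simp add: filterlim_at_top_dense)
      moreover have "eventually (\<lambda>t::real. 0 < t \<and> t \<le> 1) (at_right 0)"
        by (auto simp: eventually_at_right_field intro!: exI[of _ 1])
      ultimately have "eventually (\<lambda>t::real. False) (at_right 0)"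
        by eventually_elim (use le in force)
      then show False by simp
    qed
  qed
  then have "lower_index damped_square = Sup (ereal ` {..2})"
    unfolding lower_index_def by (simp add: atMost_def)
  also have "\<dots> = ereal 2" by (rule Sup_eqI) auto
  finally show ?thesis by simp
qed

text \<open>For \<open>q > 2\<close> the power gains more than the logarithm loses, uniformly in
  \<open>l\<close>. At \<open>q = 2\<close> the logarithmic factor alone tends to 0 for
  \<open>l = 1\<close>, so the infimum 2 is not attained.\<close>

lemma upper_index_damped_square: "upper_index damped_square = 2"
proof -
  let ?I = "{0<..1::real} \<times> {0<..1::real}"
  let ?S = "\<lambda>q. INF (l, t) \<in> ?I. ereal (damped_square (l * t) / (damped_square l * t powr q))"
  have "(?S q > 0) \<longleftrightarrow> q > 2" for q
  proof
    assume q: "q > 2"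
    \<comment> \<open>Chosen so that \<open>c * (1 + u)\<close> is at most
      \<open>1 + (q - 2) * u\<close>, hence at most \<open>exp ((q - 2) * u)\<close>.\<close>
    define c where "c = min 1 (q - 2)"
    have c: "0 < c" "c \<le> 1" "c \<le> q - 2" using q by (auto simp: c_def)
    have "ereal c \<le> ?S q"
    proof (rule INF_greatest, clarify)
      fix l t :: real assume lt: "l \<in> {0<..1}" "t \<in> {0<..1}"
      define u where "u = - ln t"
      define v where "v = - ln l"
      have uv: "u \<ge> 0" "v \<ge> 0" using lt by (auto simp: u_def v_def)
      have "c * (1 + u) \<le> 1 + (q - 2) * u"
        using c uv mult_right_mono[of c "q - 2" u] by (simp add: distrib_left)
      also have "\<dots> \<le> exp ((q - 2) * u)" by (rule exp_ge_add_one_self)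
      also have "\<dots> = t powr (2 - q)"
        using lt by (simp add: powr_def u_def algebra_simps)
      finally have 1: "c * (1 + u) \<le> t powr (2 - q)" .
      \<comment> \<open>Uniformity in \<open>l\<close>: the logarithmic factor is at least
        \<open>1 / (1 + u)\<close>, whatever \<open>v\<close> is.\<close>
      have "1 + u + v \<le> (1 + u) * (1 + v)" using uv by (simp add: distrib_left distrib_right)
      then have 2: "1 \<le> (1 + u) * ((1 + v) / (1 + v + u))"
        using uv by (simp add: le_divide_eq add_ac)
      have "c * 1 \<le> c * ((1 + u) * ((1 + v) / (1 + v + u)))"
        using 2 c by (intro mult_left_mono) auto
      also have "\<dots> \<le> t powr (2 - q) * ((1 + v) / (1 + v + u))"
        using mult_right_mono[OF 1, of "(1 + v) / (1 + v + u)"] uv by (simp add: mult.assoc)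
      finally show "ereal c \<le> ereal (damped_square (l * t) / (damped_square l * t powr q))"
        using lt by (simp add: damped_square_ratio u_def v_def)
    qed
    moreover have "0 < ereal c" using c(1) by simp
    ultimately show "?S q > 0" by (rule less_le_trans[rotated])
  next
    assume S: "?S q > 0"
    show "q > 2"
    proof (rule ccontr)
      assume "\<not> q > 2"
      then have q: "q \<le> 2" by simp
      obtain c where "0 < ereal c" "ereal c < ?S q" using ereal_dense2[OF S] by blast
      then have c: "0 < c" "ereal c \<le> ?S q" by (simp_all only: less_imp_le ereal_less)
      \<comment> \<open>The logarithmic factor at \<open>l = 1\<close> becomes
        \<open>c / (1 + c)\<close>, which is less than \<open>c\<close>.\<close>
      define t where "t = exp (- (1 / c))"
      have t: "0 < t" "t \<le> 1" "ln t = - (1 / c)" using c by (auto simp: t_def)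
      have "?S q \<le> ereal (damped_square (1 * t) / (damped_square 1 * t powr q))"
        by (rule INF_lower2[of "(1, t)"]) (use t in auto)
      with c(2) have "ereal c \<le> ereal (damped_square (1 * t) / (damped_square 1 * t powr q))"
        by (rule order_trans)
      then have "c \<le> t powr (2 - q) * (1 / (1 + 1 / c))"
        using t by (simp only: damped_square_ratio[of 1 t q]) simp
      also have "\<dots> \<le> 1 * (1 / (1 + 1 / c))"
        using t q c by (intro mult_right_mono powr_le1) auto
      also have "\<dots> < c" using c by (simp add: field_simps)
      finally show False by simp
    qed
  qed
  then have "upper_index damped_square = Inf (ereal ` {2<..})"
    unfolding upper_index_def by (simp add: greaterThan_def)
  also have "\<dots> = ereal 2"
  proof (rule Inf_eqI)
    fix y assume y: "\<And>x. x \<in> ereal ` {2<..} \<Longrightarrow> y \<le> x"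
    show "y \<le> ereal 2"
    proof (rule ereal_le_epsilon2)
      fix e :: real assume "0 < e"
      then have "ereal (2 + e) \<in> ereal ` {2<..}" by simp
      then show "y \<le> ereal 2 + ereal e" using y by simp
    qed
  qed (auto simp: less_imp_le)
  finally show ?thesis by simp
qed

text \<open>For \<open>r > c\<close> the expression equals
  \<open>4 * c\<^sup>2 / (1 - ln (c / r))\<close>, which the logarithm drives to 0. The factor
  \<open>4 * r\<^sup>2\<close> is the number of real coordinates taken up by the torus with
  \<open>n = 2 * r\<^sup>2\<close>.\<close>

lemma damped_square_small:
  assumes c: "c > 0"
  shows "\<exists>r::nat. r > 0 \<and> 4 * (real r)\<^sup>2 * damped_square (c / r) \<le> 1"
proof -
  have "((\<lambda>r::nat. 4 * c\<^sup>2 / (1 - ln (c / r))) \<longlongrightarrow> 0) at_top"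
    using c by real_asymp
  then have "eventually (\<lambda>r::nat. 4 * c\<^sup>2 / (1 - ln (c / r)) < 1) at_top"
    by (rule order_tendstoD) simp
  moreover have "eventually (\<lambda>r. real r > c) at_top"
    using filterlim_real_sequentially by (simp add: filterlim_at_top_dense)
  ultimately have "eventually (\<lambda>r::nat. r > 0 \<and> 4 * (real r)\<^sup>2 * damped_square (c / r) \<le> 1) at_top"
  proof eventually_elim
    case (elim r)
    then have r: "real r > 0" using c by linarith
    then have "\<not> c / r \<le> 0" "c / r \<le> 1" using c elim by (auto simp: not_le)
    then have "damped_square (c / r) = (c / r)\<^sup>2 / (1 - ln (c / r))"
      by (simp only: damped_square_def if_False if_True)
    then show ?case using elim r by (simp add: power_divide)
  qed
  then show ?thesis by (auto dest: eventually_happens)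
qed

section \<open>The torus in the Orlicz space\<close>

lemma finite_support_orlicz_heart:
  assumes M: "orlicz_function M" and z: "\<And>i. i \<ge> N \<Longrightarrow> z i = 0"
  shows "z \<in> orlicz_heart M"
proof -
  have "summable (\<lambda>n. M (\<bar>z n\<bar> / \<rho>))" for \<rho>
    by (rule summable_finite[of "{..<N}"]) (use M z in \<open>auto simp: orlicz_function_def\<close>)
  then show ?thesis by (auto simp: orlicz_heart_def orlicz_space_def intro: exI[of _ 1])
qed

text \<open>At radius \<open>d\<close> the sum has at most \<open>N\<close> nonzero terms, each at
  most \<open>M (b / d)\<close>, so \<open>d\<close> is admissible in the infimum.\<close>

lemma orlicz_norm_le_finite_support:
  assumes M: "orlicz_function M" and z: "\<And>i. i \<ge> N \<Longrightarrow> z i = 0" and b: "\<And>i. \<bar>z i\<bar> \<le> b"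
    and d: "d > 0" and small: "real N * M (b / d) \<le> 1"
  shows "orlicz_norm M z \<le> d"
proof -
  have zs: "z \<in> orlicz_space M"
    using finite_support_orlicz_heart[OF M z] by (simp add: orlicz_heart_def)
  have M0: "M (\<bar>z i\<bar> / d) = 0" if "i \<notin> {..<N}" for i
    using M z that by (auto simp: orlicz_function_def)
  have "(\<Sum>i. M (\<bar>z i\<bar> / d)) = (\<Sum>i<N. M (\<bar>z i\<bar> / d))"
    by (rule suminf_finite) (use M0 in auto)
  also have "\<dots> \<le> (\<Sum>i<N. M (b / d))"
    using b d by (intro sum_mono orlicz_mono[OF M]) (auto intro: divide_right_mono)
  also have "\<dots> \<le> 1" using small by simp
  finally have "d \<in> orlicz_radii M z"
    using d summable_finite[of "{..<N}" "\<lambda>i. M (\<bar>z i\<bar> / d)"] M0 by (auto simp: orlicz_radii_def)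
  then show ?thesis unfolding orlicz_norm_eq[OF zs] by (rule cInf_lower) simp
qed

text \<open>At a radius below \<open>\<bar>z i\<bar>\<close> the single term at \<open>i\<close>
  would exceed 1.\<close>

lemma orlicz_norm_ge_coordinate:
  assumes M: "orlicz_function M" and M1: "\<And>t. t > 1 \<Longrightarrow> M t > 1" and z: "z \<in> orlicz_space M"
  shows "\<bar>z i\<bar> \<le> orlicz_norm M z"
  unfolding orlicz_norm_eq[OF z]
proof (rule cInf_greatest[OF orlicz_radii_nonempty[OF M z]])
  fix \<rho> assume "\<rho> \<in> orlicz_radii M z"
  then have \<rho>: "\<rho> > 0" "summable (\<lambda>n. M (\<bar>z n\<bar> / \<rho>))" "(\<Sum>n. M (\<bar>z n\<bar> / \<rho>)) \<le> 1"
    by (auto simp: orlicz_radii_def)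
  have "M (\<bar>z i\<bar> / \<rho>) = (\<Sum>n\<in>{i}. M (\<bar>z n\<bar> / \<rho>))" by simp
  also have "\<dots> \<le> (\<Sum>n. M (\<bar>z n\<bar> / \<rho>))"
    using \<rho> by (intro sum_le_suminf) (auto simp: orlicz_pos[OF M])
  finally have "\<not> \<bar>z i\<bar> / \<rho> > 1" using \<rho>(3) M1[of "\<bar>z i\<bar> / \<rho>"] by linarith
  then show "\<bar>z i\<bar> \<le> \<rho>" using \<rho>(1) by (simp add: divide_le_eq not_less)
qed

text \<open>Coordinate \<open>j\<close> goes to a vertex of the regular \<open>m\<close>-gon of
  radius \<open>s\<close>, whose real and imaginary parts fill the places \<open>2 * j\<close> and
  \<open>2 * j + 1\<close>.\<close>

definition torus_embedding :: "real \<Rightarrow> nat \<Rightarrow> nat \<Rightarrow> (nat \<Rightarrow> nat) \<Rightarrow> nat \<Rightarrow> real" where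
  "torus_embedding s n m x i =
    (if i < 2 * n then s * (if even i then Re else Im) (unity_root m ^ x (i div 2)) else 0)"

lemma torus_embedding_shift_diff:
  assumes m: "m > 0"
  shows "torus_embedding s n m (torus_shift n m v x) i - torus_embedding s n m x i =
    (if i < 2 * n then s * (if even i then Re else Im)
      (unity_root m ^ x (i div 2) * (unity_root m ^ v (i div 2) - 1)) else 0)"
proof (cases "i < 2 * n")
  case True
  then have "unity_root m ^ torus_shift n m v x (i div 2) = unity_root m ^ x (i div 2) * unity_root m ^ v (i div 2)"
    using m by (simp add: torus_shift_def unity_root_power_mod power_add less_mult_imp_div_less mult.commute)
  then show ?thesis
    using True by (simp add: torus_embedding_def right_diff_distrib)
qed (simp add: torus_embedding_def)

text \<open>The core common to both non-embedding results. The scales \<open>d\<close> and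
  \<open>s\<close> are fixed first; then \<open>r\<close> is chosen so large that cube shifts move
  points by at most \<open>d\<close>, while half-turns move them by at least
  \<open>s\<close>.\<close>

lemma orlicz_heart_lp_obstruction:
  assumes p: "1 \<le> p" "p \<le> 2" and d: "d > 0" and s: "s > 0" and A: "A \<ge> 0" and B: "B \<ge> 0"
    and f: "\<And>x. x \<in> orlicz_heart damped_square \<Longrightarrow> f x \<in> lp_space p"
    and near: "\<And>x y. x \<in> orlicz_heart damped_square \<Longrightarrow> y \<in> orlicz_heart damped_square \<Longrightarrow>
      orlicz_norm damped_square (\<lambda>i. x i - y i) \<le> d \<Longrightarrow> lp_norm p (\<lambda>i. f x i - f y i) \<le> B"
    and far: "\<And>x y. x \<in> orlicz_heart damped_square \<Longrightarrow> y \<in> orlicz_heart damped_square \<Longrightarrow>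
      s \<le> orlicz_norm damped_square (\<lambda>i. x i - y i) \<Longrightarrow> A \<le> lp_norm p (\<lambda>i. f x i - f y i)"
  shows "A \<le> 4 * B"
proof -
  note M = orlicz_damped_square
  \<comment> \<open>A cube shift moves each of the \<open>4 * r\<^sup>2\<close> real coordinates by
    at most \<open>s * pi / r\<close>; the inequality says that the corresponding sum at radius
    \<open>d\<close> is at most 1.\<close>
  obtain r :: nat where r: "r > 0" and small: "4 * (real r)\<^sup>2 * damped_square (s * pi / d / r) \<le> 1"
    using damped_square_small[of "s * pi / d"] s d by auto
  define n where "n = 2 * r\<^sup>2"
  define m where "m = 2 * r"
  define \<phi> where "\<phi> = torus_embedding s n m"
  have m: "m > 0" using r by (simp add: m_def)
  have \<phi>0: "\<phi> x i = 0" if "i \<ge> 2 * n" for x i using that by (simp add: \<phi>_def torus_embedding_def)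
  have \<phi>: "\<phi> x \<in> orlicz_heart damped_square" for x
    by (rule finite_support_orlicz_heart[OF M \<phi>0])
  have diff: "\<phi> (torus_shift n m v x) i - \<phi> x i = (if i < 2 * n then s * (if even i then Re else Im)
      (unity_root m ^ x (i div 2) * (unity_root m ^ v (i div 2) - 1)) else 0)" for v x i
    unfolding \<phi>_def by (rule torus_embedding_shift_diff[OF m])
  show ?thesis
  proof (rule torus_lp_distance_bound[OF r n_def p A B, of "\<lambda>x. f (\<phi> x)"], unfold m_def[symmetric])
    show "f (\<phi> x) \<in> lp_space p" for x by (rule f[OF \<phi>])
  next
    fix x j assume j: "j < n"
    let ?z = "\<lambda>i. \<phi> (torus_shift n m (torus_axis j r) x) i - \<phi> x i"
    let ?w = "unity_root m ^ x j"
    \<comment> \<open>A half-turn replaces \<open>?w\<close> by its negative and moves the point by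
      \<open>2 * s\<close> in its plane; one of the two real coordinates carries at least half of
      that.\<close>
    have "norm ?w \<le> \<bar>Re ?w\<bar> + \<bar>Im ?w\<bar>" by (rule cmod_le)
    then have "1 \<le> \<bar>Re ?w\<bar> + \<bar>Im ?w\<bar>" by (simp add: norm_power)
    then consider "1 \<le> 2 * \<bar>Re ?w\<bar>" | "1 \<le> 2 * \<bar>Im ?w\<bar>" by linarith
    moreover have axis: "unity_root m ^ torus_axis j r j - 1 = -2"
      using unity_root_half[OF r] by (simp add: torus_axis_def m_def)
    have "\<bar>?z (2 * j)\<bar> = s * (2 * \<bar>Re ?w\<bar>)" "\<bar>?z (2 * j + 1)\<bar> = s * (2 * \<bar>Im ?w\<bar>)"
      using j s by (simp_all add: diff axis abs_mult)
    ultimately obtain i where i: "s \<le> \<bar>?z i\<bar>"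
      using s by (metis mult_le_cancel_left1 order_less_imp_not_less)
    have "?z \<in> orlicz_space damped_square"
      using finite_support_orlicz_heart[OF M, of "2 * n" ?z] \<phi>0 by (auto simp: orlicz_heart_def)
    then have "s \<le> orlicz_norm damped_square ?z"
      using i orlicz_norm_ge_coordinate[OF M damped_square_gt_1, of ?z i] by linarith
    then show "A \<le> lp_norm p (\<lambda>i. f (\<phi> (torus_shift n m (torus_axis j r) x)) i - f (\<phi> x) i)"
      by (rule far[OF \<phi> \<phi>])
  next
    fix x e assume e: "e \<in> discrete_torus n 2"
    let ?z = "\<lambda>i. \<phi> (torus_shift n m e x) i - \<phi> x i"
    have step: "norm (unity_root m ^ e j - 1) \<le> pi / r" if "j < n" for j
    proof -
      have "e j < 2" using e that by (auto simp: discrete_torus_def PiE_iff)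
      then have "e j = 0 \<or> e j = 1" by linarith
      then show ?thesis using norm_unity_root_minus_one[of m] by (auto simp: m_def)
    qed
    have "\<bar>?z i\<bar> \<le> s * (pi / r)" for i
    proof (cases "i < 2 * n")
      case True
      then have "i div 2 < n" by linarith
      let ?u = "unity_root m ^ x (i div 2) * (unity_root m ^ e (i div 2) - 1)"
      have "\<bar>(if even i then Re else Im) ?u\<bar> \<le> norm ?u"
        by (cases "even i") (simp_all only: if_True if_False abs_Re_le_cmod abs_Im_le_cmod)
      also have "\<dots> \<le> pi / r"
        using step[OF \<open>i div 2 < n\<close>] by (simp add: norm_mult norm_power)
      finally have "s * \<bar>(if even i then Re else Im) ?u\<bar> \<le> s * (pi / r)"
        using s by (intro mult_left_mono) auto
      then show ?thesis
        by (simp only: diff True if_True abs_mult abs_of_pos[OF s])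
    qed (use s in \<open>simp add: diff\<close>)
    then have "orlicz_norm damped_square ?z \<le> d"
      using small d by (intro orlicz_norm_le_finite_support[OF M, of "2 * n" _ "s * (pi / r)"])
        (auto simp: \<phi>0 n_def mult_ac)
    then show "lp_norm p (\<lambda>i. f (\<phi> (torus_shift n m e x)) i - f (\<phi> x) i) \<le> B"
      by (rule near[OF \<phi> \<phi>])
  qed
qed

section \<open>Non-embedding into \<open>\<ell>\<^sub>p\<close>\<close>

lemma orlicz_heart_not_coarsely_embeds_lp:
  assumes p: "1 \<le> p" "p \<le> 2"
  shows "\<not> coarsely_embeds (orlicz_heart_metric damped_square) (lp_metric p)"
proof
  note M = orlicz_damped_square
  let ?H = "orlicz_heart damped_square" and ?N = "\<lambda>x y. orlicz_norm damped_square (\<lambda>i. x i - y i)"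
  assume "coarsely_embeds (orlicz_heart_metric damped_square) (lp_metric p)"
  then obtain f \<rho>1 \<rho>2 where f: "f \<in> ?H \<rightarrow> lp_space p"
    and pos: "\<rho>1 \<in> {0..} \<rightarrow> {0..}" "\<rho>2 \<in> {0..} \<rightarrow> {0..}"
    and mono: "mono_on {0..} \<rho>1" "mono_on {0..} \<rho>2" and lim: "filterlim \<rho>1 at_top at_top"
    and bd: "\<And>x y. x \<in> ?H \<Longrightarrow> y \<in> ?H \<Longrightarrow> \<rho>1 (?N x y) \<le> lp_norm p (\<lambda>i. f x i - f y i) \<and>
      lp_norm p (\<lambda>i. f x i - f y i) \<le> \<rho>2 (?N x y)"
    unfolding coarsely_embeds_def coarse_embedding_def mspace_orlicz_heart_metric[OF M]
      mspace_lp_metric[OF p(1)] mdist_orlicz_heart_metric[OF M] mdist_lp_metric[OF p(1)]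
    by blast
  \<comment> \<open>The near scale is fixed at 1 while the far scale \<open>s\<close> is arbitrary,
    so the bound contradicts the divergence of \<open>\<rho>1\<close>.\<close>
  have "\<rho>1 s \<le> 4 * \<rho>2 1" if s: "s > 0" for s
  proof (rule orlicz_heart_lp_obstruction[OF p zero_less_one s])
    show "0 \<le> \<rho>1 s" "0 \<le> \<rho>2 1" using pos s by auto
    show "f x \<in> lp_space p" if "x \<in> ?H" for x using f that by auto
    show "lp_norm p (\<lambda>i. f x i - f y i) \<le> \<rho>2 1" if "x \<in> ?H" "y \<in> ?H" "?N x y \<le> 1" for x y
      using bd[OF that(1,2)] mono_onD[OF mono(2), of "?N x y" 1] orlicz_norm_nonneg[OF M] that(3)
      by fastforce
    show "\<rho>1 s \<le> lp_norm p (\<lambda>i. f x i - f y i)" if "x \<in> ?H" "y \<in> ?H" "s \<le> ?N x y" for x y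
      using bd[OF that(1,2)] mono_onD[OF mono(1), of s "?N x y"] s that(3) by fastforce
  qed
  moreover have "eventually (\<lambda>s. \<rho>1 s > 4 * \<rho>2 1 \<and> s > 0) at_top"
    using lim eventually_gt_at_top[of 0] by (simp add: filterlim_at_top_dense eventually_conj)
  ultimately show False
    by (auto simp: eventually_at_top_linorder) (meson linorder_not_le order_refl)
qed

text \<open>The obstruction is run at far scale 1: uniform continuity of the inverse keeps images of
  points at distance at least 1 apart by \<open>a\<close>, while that of \<open>f\<close> brings
  images of close points within \<open>a / 8\<close>.\<close>

lemma orlicz_heart_not_uniformly_embeds_lp:
  assumes p: "1 \<le> p" "p \<le> 2"
  shows "\<not> uniformly_embeds (orlicz_heart_metric damped_square) (lp_metric p)"
proof
  note M = orlicz_damped_square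
  let ?H = "orlicz_heart damped_square" and ?N = "\<lambda>x y. orlicz_norm damped_square (\<lambda>i. x i - y i)"
  assume "uniformly_embeds (orlicz_heart_metric damped_square) (lp_metric p)"
  then obtain f where inj: "inj_on f ?H"
    and uc: "uniformly_continuous_map (orlicz_heart_metric damped_square) (lp_metric p) f"
    and uci: "uniformly_continuous_map (submetric (lp_metric p) (f ` ?H))
      (orlicz_heart_metric damped_square) (inv_into ?H f)"
    unfolding uniformly_embeds_def uniform_embedding_def mspace_orlicz_heart_metric[OF M] by blast
  note defs = uniformly_continuous_map_def mdist_submetric mspace_submetric
    mspace_orlicz_heart_metric[OF M] mspace_lp_metric[OF p(1)]
    mdist_orlicz_heart_metric[OF M] mdist_lp_metric[OF p(1)]
  have f: "f x \<in> lp_space p" if "x \<in> ?H" for x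
    using conjunct1[OF uc[unfolded defs]] that by (rule funcset_mem)
  \<comment> \<open>The carrier of \<open>submetric\<close> is an intersection with the ambient
    space; this identifies it with the image.\<close>
  then have img: "f ` ?H \<inter> lp_space p = f ` ?H" by blast
  obtain a where a: "a > 0" and inv: "\<forall>u\<in>f ` ?H. \<forall>v\<in>f ` ?H.
      lp_norm p (\<lambda>i. v i - u i) < a \<longrightarrow> ?N (inv_into ?H f v) (inv_into ?H f u) < 1"
    using conjunct2[OF uci[unfolded defs img], THEN spec, THEN mp, OF zero_less_one]
    by (elim exE conjE) (rule that)
  \<comment> \<open>Any value below \<open>a / 4\<close> contradicts the factor 4 of the
    obstruction.\<close>
  have a8: "0 < a / 8" using a by simp
  obtain d where d: "d > 0" and near: "\<forall>y\<in>?H. \<forall>x\<in>?H.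
      ?N x y < d \<longrightarrow> lp_norm p (\<lambda>i. f x i - f y i) < a / 8"
    using conjunct2[OF uc[unfolded defs], THEN spec, THEN mp, OF a8]
    by (elim exE conjE) (rule that)
  have "a \<le> 4 * (a / 8)"
  \<comment> \<open>Halving \<open>d\<close> passes from the non-strict nearness of the obstruction
    to the strict one of uniform continuity.\<close>
  proof (rule orlicz_heart_lp_obstruction[OF p _ zero_less_one, of "d / 2"])
    show "lp_norm p (\<lambda>i. f x i - f y i) \<le> a / 8" if "x \<in> ?H" "y \<in> ?H" "?N x y \<le> d / 2" for x y
    proof -
      have "?N x y < d" using that(3) d by linarith
      then show ?thesis using near that(1,2) by (simp add: less_imp_le)
    qed
    show "a \<le> lp_norm p (\<lambda>i. f x i - f y i)" if "x \<in> ?H" "y \<in> ?H" "1 \<le> ?N x y" for x y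
    proof (rule ccontr)
      assume "\<not> ?thesis"
      then have "?N (inv_into ?H f (f x)) (inv_into ?H f (f y)) < 1"
        using that(1,2) inv by simp
      then show False using that(3) by (simp only: inv_into_f_f[OF inj] that(1,2))
    qed
    show "d / 2 > 0" "0 \<le> a" "0 \<le> a / 8" using a d by simp_all
  qed (rule f)
  then show False using a by simp
qed

theorem mainTheorem3:
  shows "\<exists>M :: real \<Rightarrow> real.
    orlicz_function M \<and> nondegenerate M \<and> lower_index M = 2 \<and> upper_index M = 2 \<and>
    (\<forall>p::real. 1 \<le> p \<and> p \<le> 2 \<longrightarrow>
       \<not> coarsely_embeds (orlicz_heart_metric M) (lp_metric p) \<and>
       \<not> uniformly_embeds (orlicz_heart_metric M) (lp_metric p))"
  using orlicz_damped_square nondegenerate_damped_square lower_index_damped_square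
    upper_index_damped_square orlicz_heart_not_coarsely_embeds_lp orlicz_heart_not_uniformly_embeds_lp
  by blast

end
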